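(* Let $G$ be a hyperbolic group with finite inverse-closed generating set $X$, and let $H$ be a quasiconvex subgroup of $G$. Suppose that either (i) $H$ is almost malnormal in $G$; or (ii) the index $|C_G(h):C_H(h)|$ is finite for every $1 \ne h \in H$. Then $\mathsf{GWP}(G,H,X)$ is a real-time language.
   Context: For a group $G$ with finite generating set $X$ (closed under inverses) and a subgroup $H \le G$, the generalised word problem $\mathsf{GWP}(G,H,X)$ is the set of words over $X$ that represent elements of $H$. A language is real-time if it is accepted by a real-time Turing machine (a deterministic multi-tape Turing machine that reads one input symbol per step and performs only a bounded number of operations per input symbol). A subgroup $H$ is quasiconvex in $G$ if there is a constant $\kappa$ such that every geodesic word over $X$ representing an element of $H$ stays within distance $\kappa$ of $H$ in the Cayley graph $\Gamma(G,X)$. $H$ is almost malnormal in $G$ if $H \cap gHg^{-1}$ is finite for all $g \in G \setminus H$. $C_G(h)$ denotes the centraliser of $h$ in $G$ and $C_H(h) = C_G(h)\cap H$. *)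

theory Defs
  imports "HOL-Algebra.Algebra"
begin

definition word_eval :: "('g, 'b) monoid_scheme \<Rightarrow> 'g list \<Rightarrow> 'g" where
  "word_eval G w = foldr (\<lambda>x y. x \<otimes>\<^bsub>G\<^esub> y) w \<one>\<^bsub>G\<^esub>"

definition word_length :: "('g, 'b) monoid_scheme \<Rightarrow> 'g set \<Rightarrow> 'g \<Rightarrow> nat" where
  "word_length G S g = (LEAST n. \<exists>w \<in> lists S. length w = n \<and> word_eval G w = g)"

definition cayley_dist :: "('g, 'b) monoid_scheme \<Rightarrow> 'g set \<Rightarrow> 'g \<Rightarrow> 'g \<Rightarrow> nat" where
  "cayley_dist G S g h = word_length G S (inv\<^bsub>G\<^esub> g \<otimes>\<^bsub>G\<^esub> h)"

definition geodesic_word :: "('g, 'b) monoid_scheme \<Rightarrow> 'g set \<Rightarrow> 'g list \<Rightarrow> bool" where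
  "geodesic_word G S w \<longleftrightarrow> w \<in> lists S \<and> length w = word_length G S (word_eval G w)"

definition fin_inv_gen_set :: "('g, 'b) monoid_scheme \<Rightarrow> 'g set \<Rightarrow> bool" where
  "fin_inv_gen_set G S \<longleftrightarrow> finite S \<and> S \<subseteq> carrier G \<and>
     (\<forall>x \<in> S. inv\<^bsub>G\<^esub> x \<in> S) \<and> generate G S = carrier G"

definition path_points :: "('g, 'b) monoid_scheme \<Rightarrow> 'g \<Rightarrow> 'g list \<Rightarrow> 'g set" where
  "path_points G g w = {g \<otimes>\<^bsub>G\<^esub> word_eval G (take i w) | i. i \<le> length w}"

definition close_to :: "('g, 'b) monoid_scheme \<Rightarrow> 'g set \<Rightarrow> nat \<Rightarrow> 'g set \<Rightarrow> 'g set \<Rightarrow> bool" where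
  "close_to G S d P Q \<longleftrightarrow> (\<forall>p \<in> P. \<exists>q \<in> Q. cayley_dist G S p q \<le> d)"

text \<open>Every geodesic triangle (by left-invariance, w.l.o.g. with a vertex at 1, with sides
  labelled by geodesic words u, v, w where u v = w in G) is delta-slim.\<close>
definition hyperbolic_group :: "('g, 'b) monoid_scheme \<Rightarrow> 'g set \<Rightarrow> bool" where
  "hyperbolic_group G S \<longleftrightarrow> group G \<and> fin_inv_gen_set G S \<and>
     (\<exists>\<delta>::nat. \<forall>u v w. geodesic_word G S u \<longrightarrow> geodesic_word G S v \<longrightarrow> geodesic_word G S w \<longrightarrow>
        word_eval G u \<otimes>\<^bsub>G\<^esub> word_eval G v = word_eval G w \<longrightarrow>
        (let P1 = path_points G \<one>\<^bsub>G\<^esub> u;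
             P2 = path_points G (word_eval G u) v;
             P3 = path_points G \<one>\<^bsub>G\<^esub> w
         in close_to G S \<delta> P1 (P2 \<union> P3) \<and> close_to G S \<delta> P2 (P1 \<union> P3) \<and>
            close_to G S \<delta> P3 (P1 \<union> P2)))"

definition quasiconvex :: "('g, 'b) monoid_scheme \<Rightarrow> 'g set \<Rightarrow> 'g set \<Rightarrow> bool" where
  "quasiconvex G S H \<longleftrightarrow> (\<exists>\<kappa>::nat. \<forall>w. geodesic_word G S w \<longrightarrow> word_eval G w \<in> H \<longrightarrow>
      (\<forall>p \<in> path_points G \<one>\<^bsub>G\<^esub> w. \<exists>h \<in> H. cayley_dist G S p h \<le> \<kappa>))"

definition almost_malnormal :: "('g, 'b) monoid_scheme \<Rightarrow> 'g set \<Rightarrow> bool" where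
  "almost_malnormal G H \<longleftrightarrow>
     (\<forall>g \<in> carrier G - H. finite (H \<inter> {g \<otimes>\<^bsub>G\<^esub> h \<otimes>\<^bsub>G\<^esub> inv\<^bsub>G\<^esub> g | h. h \<in> H}))"

definition centraliser :: "('g, 'b) monoid_scheme \<Rightarrow> 'g \<Rightarrow> 'g set" where
  "centraliser G h = {g \<in> carrier G. g \<otimes>\<^bsub>G\<^esub> h = h \<otimes>\<^bsub>G\<^esub> g}"

definition finite_centraliser_index :: "('g, 'b) monoid_scheme \<Rightarrow> 'g set \<Rightarrow> 'g \<Rightarrow> bool" where
  "finite_centraliser_index G H h \<longleftrightarrow>
     finite {(centraliser G h \<inter> H) #>\<^bsub>G\<^esub> g | g. g \<in> centraliser G h}"

definition GWP :: "('g, 'b) monoid_scheme \<Rightarrow> 'g set \<Rightarrow> 'g set \<Rightarrow> 'g list set" where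
  "GWP G H S = {w \<in> lists S. word_eval G w \<in> H}"

text \<open>A deterministic k-tape machine; states and tape symbols are natural numbers drawn from
  finite sets Q and Gamma, blank symbol 0. A configuration is (state, tapes, head positions).
  Each input symbol triggers exactly one move: depending on state, input symbol and the k scanned
  symbols, it enters a new state, writes a symbol on each work tape and moves each head by -1, 0 or 1.\<close>
type_synonym config = "nat \<times> (int \<Rightarrow> nat) list \<times> int list"

definition tm_step :: "(nat \<Rightarrow> 'a \<Rightarrow> nat list \<Rightarrow> nat \<times> nat list \<times> int list) \<Rightarrow> config \<Rightarrow> 'a \<Rightarrow> config" where
  "tm_step \<delta> c a = (case c of (q, ts, hs) \<Rightarrow>
     (case \<delta> q a (map2 (\<lambda>t h. t h) ts hs) of (q', ws, ms) \<Rightarrow>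
       (q', map2 (\<lambda>(t, h) s. t(h := s)) (zip ts hs) ws, map2 (+) hs ms)))"

definition tm_run :: "(nat \<Rightarrow> 'a \<Rightarrow> nat list \<Rightarrow> nat \<times> nat list \<times> int list) \<Rightarrow> config \<Rightarrow> 'a list \<Rightarrow> config" where
  "tm_run \<delta> c w = foldl (tm_step \<delta>) c w"

definition real_time_language :: "'a set \<Rightarrow> 'a list set \<Rightarrow> bool" where
  "real_time_language \<Sigma> L \<longleftrightarrow> L \<subseteq> lists \<Sigma> \<and>
     (\<exists>(k::nat) (Q::nat set) (\<Gamma>::nat set) q0 F \<delta>.
        finite Q \<and> finite \<Gamma> \<and> 0 \<in> \<Gamma> \<and> q0 \<in> Q \<and> F \<subseteq> Q \<and>
        (\<forall>q \<in> Q. \<forall>a \<in> \<Sigma>. \<forall>ss. length ss = k \<longrightarrow> set ss \<subseteq> \<Gamma> \<longrightarrow>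
            (case \<delta> q a ss of (q', ws, ms) \<Rightarrow>
               q' \<in> Q \<and> length ws = k \<and> set ws \<subseteq> \<Gamma> \<and> length ms = k \<and> set ms \<subseteq> {-1, 0, 1})) \<and>
        (\<forall>w \<in> lists \<Sigma>. w \<in> L \<longleftrightarrow>
            fst (tm_run \<delta> (q0, replicate k (\<lambda>_. 0), replicate k 0) w) \<in> F))"

end

theory Submission
  imports Defs
begin

text \<open>A prefix \<open>g\<close> of the input is kept, up to left multiplication by \<open>H\<close>, as a product of geodesic
  blocks \<open>b\<^sub>1 \<dots> b\<^sub>n y\<close> such that consecutive blocks lose only a bounded amount of length when
  multiplied, and \<open>b\<^sub>1\<close> is almost shortest in its coset \<open>H b\<^sub>1\<close>. By the four-point inequality such a
  local geodesic is global: since \<open>H\<close> is quasiconvex, it leaves \<open>H\<close> almost perpendicularly, and the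
  distance from \<open>H\<close> to \<open>g\<close> is at least half the total length of the blocks. Hence \<open>g \<in> H\<close> forces
  \<open>n = 0\<close>.

  Multiplication by a generator may destroy the condition at the top, and repairing it may cascade
  down the stack of blocks while further letters wait in a queue. Each repair shortens the
  product by a definite amount, so the number of steps is a small fraction of the length at which
  the cascade started. The distance to \<open>H\<close> was proportional to that length with a larger constant and
  drops by at most one per letter, so a word read during a cascade is never in \<open>H\<close> and can be rejected
  at once.\<close>

section \<open>Word length and the four-point inequality\<close>

locale cayley = group G for G :: "('g, 'b) monoid_scheme" (structure) +
  fixes S :: "'g set"
  assumes gen: "fin_inv_gen_set G S"
begin

abbreviation len :: "'g \<Rightarrow> nat" where "len \<equiv> word_length G S"
abbreviation dst :: "'g \<Rightarrow> 'g \<Rightarrow> nat" where "dst \<equiv> cayley_dist G S"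
abbreviation ev :: "'g list \<Rightarrow> 'g" where "ev \<equiv> word_eval G"

lemma S_carrier: "x \<in> S \<Longrightarrow> x \<in> carrier G"
  and S_inv: "x \<in> S \<Longrightarrow> inv x \<in> S"
  and S_finite: "finite S"
  and S_generate: "generate G S = carrier G"
  using gen unfolding fin_inv_gen_set_def by auto

lemma ev_Nil [simp]: "ev [] = \<one>"
  and ev_Cons [simp]: "ev (x # w) = x \<otimes> ev w"
  by (simp_all add: word_eval_def)

lemma ev_closed [simp]: "w \<in> lists S \<Longrightarrow> ev w \<in> carrier G"
  by (induction w) (auto simp: S_carrier)

lemma take_lists [simp]: "w \<in> lists S \<Longrightarrow> take i w \<in> lists S"
  and drop_lists [simp]: "w \<in> lists S \<Longrightarrow> drop i w \<in> lists S"
  by (meson in_lists_conv_set in_set_takeD in_set_dropD)+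

lemma ev_append: "v \<in> lists S \<Longrightarrow> w \<in> lists S \<Longrightarrow> ev (v @ w) = ev v \<otimes> ev w"
  by (induction v) (auto simp: S_carrier m_assoc)

lemma ex_inverse_word: "w \<in> lists S \<Longrightarrow> \<exists>v \<in> lists S. length v = length w \<and> ev v = inv (ev w)"
proof (induction w)
  case (Cons x w)
  then obtain v where v: "v \<in> lists S" "length v = length w" "ev v = inv (ev w)" by auto
  show ?case
  proof (rule bexI[of _ "v @ [inv x]"])
    show "length (v @ [inv x]) = length (x # w) \<and> ev (v @ [inv x]) = inv (ev (x # w))"
      using Cons v by (auto simp: ev_append S_carrier S_inv inv_mult_group)
  qed (use Cons v in \<open>auto simp: S_inv\<close>)
qed auto

lemma ex_word: assumes "g \<in> carrier G" shows "\<exists>w \<in> lists S. ev w = g"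
proof -
  have "g \<in> generate G S" using assms S_generate by simp
  then show ?thesis
  proof (induction rule: generate.induct)
    case one
    show ?case by (rule bexI[of _ "[]"]) auto
  next
    case (incl h)
    then show ?case by (intro bexI[of _ "[h]"]) (auto simp: S_carrier)
  next
    case (inv h)
    then show ?case by (intro bexI[of _ "[inv h]"]) (auto simp: S_carrier S_inv)
  next
    case (eng h1 h2)
    then obtain v w where "v \<in> lists S" "w \<in> lists S" "ev v = h1" "ev w = h2" by auto
    then show ?case by (intro bexI[of _ "v @ w"]) (auto simp: ev_append)
  qed
qed

lemma len_le: "w \<in> lists S \<Longrightarrow> len (ev w) \<le> length w"
  unfolding word_length_def by (rule Least_le) auto

lemma ex_geodesic:
  assumes "g \<in> carrier G"
  shows "\<exists>w \<in> lists S. length w = len g \<and> ev w = g"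
proof -
  have "\<exists>n. \<exists>w \<in> lists S. length w = n \<and> ev w = g" using ex_word[OF assms] by blast
  from LeastI_ex[OF this] show ?thesis unfolding word_length_def .
qed

lemma len_one [simp]: "len \<one> = 0"
  using len_le[of "[]"] by simp

lemma len_gen: "s \<in> S \<Longrightarrow> len s \<le> 1"
  using len_le[of "[s]"] by (simp add: S_carrier)

lemma len_mult: assumes "g \<in> carrier G" "h \<in> carrier G" shows "len (g \<otimes> h) \<le> len g + len h"
proof -
  obtain v w where "v \<in> lists S" "w \<in> lists S" "length v = len g" "ev v = g" "length w = len h" "ev w = h"
    using assms ex_geodesic by meson
  then show ?thesis using len_le[of "v @ w"] by (simp add: ev_append)
qed

lemma len_inv_le: assumes "g \<in> carrier G" shows "len (inv g) \<le> len g"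
  using ex_geodesic[OF assms] ex_inverse_word len_le by metis

lemma len_inv: assumes "g \<in> carrier G" shows "len (inv g) = len g"
  using len_inv_le[OF assms] len_inv_le[of "inv g"] assms by simp

lemma finite_ball: "finite {g \<in> carrier G. len g \<le> r}"
proof (rule finite_subset)
  show "{g \<in> carrier G. len g \<le> r} \<subseteq> ev ` {w. set w \<subseteq> S \<and> length w \<le> r}"
    using ex_geodesic by (fastforce simp: image_iff lists_eq_set)
qed (simp add: finite_lists_length_le S_finite)

lemma dst_one [simp]: "x \<in> carrier G \<Longrightarrow> dst \<one> x = len x"
  and dst_self [simp]: "x \<in> carrier G \<Longrightarrow> dst x x = 0"
  by (simp_all add: cayley_dist_def)

lemma dst_sym: "x \<in> carrier G \<Longrightarrow> y \<in> carrier G \<Longrightarrow> dst x y = dst y x"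
  using len_inv[of "inv x \<otimes> y"] by (simp add: cayley_dist_def inv_mult_group)

lemma dst_mult_right [simp]: "x \<in> carrier G \<Longrightarrow> y \<in> carrier G \<Longrightarrow> dst x (x \<otimes> y) = len y"
  by (simp add: cayley_dist_def m_assoc[symmetric])

lemma dst_left:
  "g \<in> carrier G \<Longrightarrow> x \<in> carrier G \<Longrightarrow> y \<in> carrier G \<Longrightarrow> dst (g \<otimes> x) (g \<otimes> y) = dst x y"
proof -
  assume *: "g \<in> carrier G" "x \<in> carrier G" "y \<in> carrier G"
  have "inv (g \<otimes> x) \<otimes> (g \<otimes> y) = inv x \<otimes> ((inv g \<otimes> g) \<otimes> y)"
    using * by (simp only: inv_mult_group m_assoc inv_closed m_closed)
  then show ?thesis using * by (simp add: cayley_dist_def)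
qed

lemma dst_triangle:
  assumes "x \<in> carrier G" "y \<in> carrier G" "z \<in> carrier G"
  shows "dst x z \<le> dst x y + dst y z"
proof -
  have "inv x \<otimes> z = (inv x \<otimes> y) \<otimes> (inv y \<otimes> z)"
    using assms by (metis (no_types, lifting) inv_closed m_assoc m_closed r_inv r_one)
  then show ?thesis using len_mult[of "inv x \<otimes> y" "inv y \<otimes> z"] assms by (simp add: cayley_dist_def)
qed

text \<open>Neither half of a cut word is longer than its number of letters, while together they
  must reach the length of the whole; so both estimates are equalities.\<close>

lemma geodesic_take:
  assumes w: "w \<in> lists S" "length w = len (ev w)" and i: "i \<le> length w"
  shows "len (ev (take i w)) = i" "len (ev (drop i w)) = length w - i"
    "ev w = ev (take i w) \<otimes> ev (drop i w)"
proof -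
  have t: "take i w \<in> lists S" "drop i w \<in> lists S"
    using w by simp_all
  show e: "ev w = ev (take i w) \<otimes> ev (drop i w)"
    using ev_append[OF t] by simp
  show "len (ev (take i w)) = i" "len (ev (drop i w)) = length w - i"
    using len_le[OF t(1)] len_le[OF t(2)] len_mult[OF ev_closed[OF t(1)] ev_closed[OF t(2)]]
      w(2) i unfolding e[symmetric] length_take length_drop by linarith+
qed

lemma dst_take:
  assumes w: "w \<in> lists S" "length w = len (ev w)" and "i \<le> j" "j \<le> length w"
  shows "dst (ev (take i w)) (ev (take j w)) \<le> j - i"
proof -
  define v where "v = take j w"
  have v: "v \<in> lists S" "take i v = take i w" "length v = j"
    using w assms by (simp_all add: v_def min_def)
  have t: "take i v \<in> lists S" "drop i v \<in> lists S"
    using v(1) by simp_all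
  have "ev v = ev (take i v) \<otimes> ev (drop i v)" using ev_append[OF t] by simp
  then have "dst (ev (take i v)) (ev v) = len (ev (drop i v))" using t by simp
  then show ?thesis using len_le[OF t(2)] v v_def by simp
qed

lemma split_ex:
  assumes "g \<in> carrier G" "m \<le> len g"
  shows "\<exists>z. z \<in> carrier G \<and> len z = m \<and> len (inv z \<otimes> g) = len g - m"
proof -
  obtain w where w: "w \<in> lists S" "length w = len g" "ev w = g" using ex_geodesic assms by blast
  have t: "take m w \<in> lists S" "drop m w \<in> lists S"
    using w by simp_all
  have "inv (ev (take m w)) \<otimes> (ev (take m w) \<otimes> ev (drop m w)) = ev (drop m w)"
    using t by (simp add: m_assoc[symmetric])
  moreover note geodesic_take[of w m] ev_closed[OF t(1)]
  ultimately show ?thesis using w assms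
    by (intro exI[of _ "ev (take m w)"]) metis
qed

text \<open>A point on some geodesic from 1 to \<open>g\<close>, chosen as a function of
  \<open>g\<close> because a deterministic machine has to cut there. Which geodesic is taken does
  not matter, only the two lengths do.\<close>

definition pre :: "nat \<Rightarrow> 'g \<Rightarrow> 'g" where
  "pre m g = (SOME z. z \<in> carrier G \<and> len z = m \<and> len (inv z \<otimes> g) = len g - m)"

definition suf :: "nat \<Rightarrow> 'g \<Rightarrow> 'g" where
  "suf m g = inv (pre m g) \<otimes> g"

lemma pre_suf:
  assumes "g \<in> carrier G" "m \<le> len g"
  shows "pre m g \<in> carrier G" "len (pre m g) = m" "suf m g \<in> carrier G" "len (suf m g) = len g - m"
    "pre m g \<otimes> suf m g = g"
proof -
  show p: "pre m g \<in> carrier G" "len (pre m g) = m" "len (suf m g) = len g - m"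
    using someI_ex[OF split_ex[OF assms]] by (auto simp: pre_def suf_def)
  then show "suf m g \<in> carrier G" "pre m g \<otimes> suf m g = g"
    using assms by (auto simp: suf_def m_assoc[symmetric])
qed

end

section \<open>From slim triangles to the four-point inequality\<close>

locale hyperbolic = cayley +
  fixes \<delta> :: nat
  assumes slim: "\<And>u v w. \<lbrakk>geodesic_word G S u; geodesic_word G S v; geodesic_word G S w;
       ev u \<otimes> ev v = ev w\<rbrakk> \<Longrightarrow>
       close_to G S \<delta> (path_points G \<one> w) (path_points G \<one> u \<union> path_points G (ev u) v)"
begin

lemma path_point_between:
  assumes w: "w \<in> lists S" "length w = len (ev w)" and "x \<in> carrier G" "q \<in> path_points G x w"
  shows "q \<in> carrier G" "dst x q + dst q (x \<otimes> ev w) = dst x (x \<otimes> ev w)"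
proof -
  obtain i where i: "i \<le> length w" "q = x \<otimes> ev (take i w)"
    using assms by (auto simp: path_points_def)
  have t: "take i w \<in> lists S" "drop i w \<in> lists S"
    using w by simp_all
  show "q \<in> carrier G" using i t assms by simp
  have "x \<otimes> ev w = q \<otimes> ev (drop i w)"
    unfolding geodesic_take(3)[OF w i(1)] i(2) using t assms(3) by (simp add: m_assoc)
  then have "dst q (x \<otimes> ev w) = length w - i" "dst x q = i"
    using geodesic_take(1,2)[OF w i(1)] \<open>q \<in> carrier G\<close> i(2) t assms(3) by simp_all
  moreover have "dst x (x \<otimes> ev w) = length w" using w assms(3) by simp
  ultimately show "dst x q + dst q (x \<otimes> ev w) = dst x (x \<otimes> ev w)" using i(1) by simp
qed

text \<open>The last point of \<open>w\<close> that is close to the side from \<open>\<one>\<close> to \<open>a\<close> is almost close to the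
  other side as well.\<close>

lemma triangle_centre:
  assumes w: "w \<in> lists S" "length w = len (ev w)" and a: "a \<in> carrier G"
  shows "\<exists>i \<le> length w. i + dst (ev (take i w)) a \<le> len a + 2 * \<delta> + 2 \<and>
     dst (ev (take i w)) a + (length w - i) \<le> dst a (ev w) + 2 * \<delta> + 2"
proof -
  define c where "c = ev w"
  have c: "c \<in> carrier G" using w by (simp add: c_def)
  obtain u where u: "u \<in> lists S" "length u = len (ev u)" "ev u = a" using ex_geodesic[OF a] by auto
  obtain v where v: "v \<in> lists S" "length v = len (ev v)" "ev v = inv a \<otimes> c"
    using ex_geodesic[of "inv a \<otimes> c"] a c by auto
  have avc: "a \<otimes> ev v = c" using v a c by (simp add: m_assoc[symmetric])
  have close: "close_to G S \<delta> (path_points G \<one> w) (path_points G \<one> u \<union> path_points G a v)"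
    using slim[of u v w] u v w avc by (auto simp: geodesic_word_def c_def)
  let ?p = "\<lambda>i. ev (take i w)"
  have pc: "?p i \<in> carrier G" for i
    using w by simp
  have pp: "?p i \<in> path_points G \<one> w" if "i \<le> length w" for i
    using that pc unfolding path_points_def by force
  define P where "P i \<longleftrightarrow> i \<le> length w \<and> (\<exists>q \<in> path_points G \<one> u. dst (?p i) q \<le> \<delta>)" for i
  have "\<one> \<in> path_points G \<one> u" unfolding path_points_def by (force intro: exI[of _ 0])
  then have "P 0" unfolding P_def by (auto intro!: bexI[of _ \<one>])
  moreover have "\<forall>i. P i \<longrightarrow> i \<le> length w" by (simp add: P_def)
  ultimately obtain i where i: "P i" "\<And>j. P j \<Longrightarrow> j \<le> i"
    by (metis GreatestI_nat Greatest_le_nat)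
  \<comment> \<open>At the end of \<open>w\<close> the endpoint itself lies on \<open>v\<close>.
    Otherwise the next point is no longer close to \<open>u\<close>, hence close to
    \<open>v\<close>, and the step to it costs the extra 1.\<close>
  have "\<exists>q \<in> path_points G a v. dst (?p i) q \<le> \<delta> + 1"
  proof (cases "i = length w")
    case True
    have "c \<in> path_points G a v" unfolding path_points_def using avc by (force intro: exI[of _ "length v"])
    then show ?thesis using True c by (intro bexI[of _ c]) (auto simp: c_def)
  next
    case False
    then have Si: "Suc i \<le> length w" using i by (simp add: P_def)
    have "\<not> P (Suc i)" using i by force
    then obtain q where q: "q \<in> path_points G a v" "dst (?p (Suc i)) q \<le> \<delta>"
      using close pp[OF Si] Si unfolding close_to_def P_def by blast
    have "q \<in> carrier G" using path_point_between[OF v(1,2) a q(1)] by simp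
    then show ?thesis using dst_triangle[OF pc pc, of q i "Suc i"] dst_take[OF w, of i "Suc i"] Si q
      by (intro bexI[OF _ q(1)]) auto
  qed
  then obtain r where r: "r \<in> path_points G a v" "dst (?p i) r \<le> \<delta> + 1" by auto
  obtain q where q: "q \<in> path_points G \<one> u" "dst (?p i) q \<le> \<delta>" using i by (auto simp: P_def)
  have iw: "i \<le> length w" using i by (simp add: P_def)
  note qb = path_point_between[OF u(1,2) one_closed q(1)]
  note rb = path_point_between[OF v(1,2) a r(1)]
  have 1: "dst \<one> (?p i) = i" "dst (?p i) c = length w - i"
  proof -
    show "dst \<one> (?p i) = i" using geodesic_take(1)[OF w iw] pc[of i] by simp
    have "dst (?p i) (?p i \<otimes> ev (drop i w)) = length w - i"
      using geodesic_take(2)[OF w iw] pc[of i] w(1) by simp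
    then show "dst (?p i) c = length w - i" using geodesic_take(3)[OF w iw] by (simp add: c_def)
  qed
  show ?thesis
  proof (intro exI conjI)
    have "dst \<one> (?p i) \<le> dst \<one> q + dst (?p i) q" "dst (?p i) a \<le> dst (?p i) q + dst q a"
      using dst_triangle[of \<one> q "?p i"] dst_triangle[of "?p i" q a] qb a pc[of i] dst_sym[of q "?p i"] by auto
    then show "i + dst (?p i) a \<le> len a + 2 * \<delta> + 2" using qb q a u 1 by auto
    have "dst (?p i) a \<le> dst (?p i) r + dst a r" "dst (?p i) c \<le> dst (?p i) r + dst r c"
      using dst_triangle[of "?p i" r a] dst_triangle[of "?p i" r c] rb a c pc[of i] dst_sym[of r a] by auto
    then show "dst (?p i) a + (length w - i) \<le> dst a (ev w) + 2 * \<delta> + 2"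
      using rb r avc 1 by (auto simp: c_def)
  qed (rule iw)
qed

text \<open>Both \<open>a\<close> and \<open>b\<close> have a centre on one geodesic from 1 to
  \<open>c\<close>, and the path through the two centres bounds \<open>dst a b\<close>. Each centre
  costs \<open>2 * \<delta> + 2\<close>; the order of the two on the geodesic decides which term of
  the maximum is reached.\<close>

lemma four_point_one:
  assumes a: "a \<in> carrier G" and b: "b \<in> carrier G" and c: "c \<in> carrier G"
  shows "len c + dst a b \<le> max (len a + dst b c) (len b + dst a c) + (4 * \<delta> + 4)"
proof -
  obtain w where w: "w \<in> lists S" "length w = len (ev w)" "ev w = c" using ex_geodesic[OF c] by auto
  let ?p = "\<lambda>i. ev (take i w)"
  have pc: "?p i \<in> carrier G" for i
    using w by simp
  obtain i where i: "i \<le> length w" "i + dst (?p i) a \<le> len a + 2 * \<delta> + 2"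
     "dst (?p i) a + (length w - i) \<le> dst a c + 2 * \<delta> + 2"
    using triangle_centre[OF w(1,2) a] w by auto
  obtain j where j: "j \<le> length w" "j + dst (?p j) b \<le> len b + 2 * \<delta> + 2"
     "dst (?p j) b + (length w - j) \<le> dst b c + 2 * \<delta> + 2"
    using triangle_centre[OF w(1,2) b] w by auto
  have ij: "dst (?p i) (?p j) \<le> (if i \<le> j then j - i else i - j)"
    using dst_take[OF w(1,2), of i j] dst_take[OF w(1,2), of j i] dst_sym[OF pc pc, of i j] i j by auto
  have "dst a b \<le> dst (?p i) a + (dst (?p i) (?p j) + dst (?p j) b)"
    using dst_triangle[of a "?p i" b] dst_triangle[of "?p i" "?p j" b] dst_sym[of a "?p i"] a b pc
    by (smt (verit) add.commute add_le_cancel_left le_trans)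
  then show ?thesis using i j ij w by (auto split: if_splits)
qed

text \<open>Distances are left invariant, so \<open>x\<close> may be moved to 1.\<close>

lemma four_point:
  assumes x: "x \<in> carrier G" and y: "y \<in> carrier G" and z: "z \<in> carrier G" and w: "w \<in> carrier G"
  shows "dst x z + dst y w \<le> max (dst x y + dst w z) (dst x w + dst y z) + (4 * \<delta> + 4)"
proof -
  have "dst (inv x \<otimes> p) (inv x \<otimes> q) = dst p q" if "p \<in> carrier G" "q \<in> carrier G" for p q
    using dst_left[of "inv x"] x that by simp
  then show ?thesis using four_point_one[of "inv x \<otimes> y" "inv x \<otimes> w" "inv x \<otimes> z"] assms
    by (simp add: cayley_dist_def)
qed

end

section \<open>Real-time machines with stacks\<close>

datatype 's stack_op = Keep | Pop | Push 's

fun apply_op :: "'s stack_op \<Rightarrow> 's list \<Rightarrow> 's list" where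
  "apply_op Keep st = st"
| "apply_op Pop st = tl st"
| "apply_op (Push x) st = x # st"

fun top_of :: "'s list \<Rightarrow> 's option" where
  "top_of [] = None"
| "top_of (x # st) = Some x"

definition stack_step ::
  "('q \<Rightarrow> 'a \<Rightarrow> 's option list \<Rightarrow> 'q \<times> 's stack_op list) \<Rightarrow> 'q \<times> 's list list \<Rightarrow> 'a \<Rightarrow> 'q \<times> 's list list" where
  "stack_step \<delta> c a = (case c of (q, sts) \<Rightarrow>
     (case \<delta> q a (map top_of sts) of (q', acts) \<Rightarrow> (q', map2 apply_op acts sts)))"

lemma top_of_in_set: "top_of st = Some x \<Longrightarrow> x \<in> set st"
  by (cases st) auto

lemma set_apply_op: "set (apply_op a st) \<subseteq> set st \<union> set_stack_op a"
  by (cases a; cases st) auto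

text \<open>A tape stores its stack below the head, bottom blank included. A head moves only after it
  writes, so a push could not both see the new top and store the old one; hence the control may
  hold the top of the stack itself, with the head on the free cell above the rest.\<close>

primrec on_tape :: "('s \<Rightarrow> nat) \<Rightarrow> (int \<Rightarrow> nat) \<Rightarrow> int \<Rightarrow> 's list \<Rightarrow> bool" where
  "on_tape enc t h [] \<longleftrightarrow> t h = 0"
| "on_tape enc t h (x # st) \<longleftrightarrow> t h = enc x \<and> on_tape enc t (h - 1) st"

fun tape_rel :: "('s \<Rightarrow> nat) \<Rightarrow> 's option \<Rightarrow> (int \<Rightarrow> nat) \<Rightarrow> int \<Rightarrow> 's list \<Rightarrow> bool" where
  "tape_rel enc None t h st \<longleftrightarrow> on_tape enc t h st"
| "tape_rel enc (Some x) t h st \<longleftrightarrow> (\<exists>st'. st = x # st' \<and> on_tape enc t (h - 1) st')"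

fun visible :: "(nat \<Rightarrow> 's option) \<Rightarrow> 's option \<Rightarrow> nat \<Rightarrow> 's option" where
  "visible dec None s = dec s"
| "visible dec (Some x) s = Some x"

fun new_buffer :: "'s option \<Rightarrow> 's stack_op \<Rightarrow> 's option" where
  "new_buffer b Keep = b"
| "new_buffer b Pop = None"
| "new_buffer b (Push x) = Some x"

text \<open>Only a push onto a full buffer alters the tape: the old top goes from the control into
  the free cell. A popped symbol is not erased; nothing above the stack is consulted before it is
  overwritten.\<close>

fun written :: "('s \<Rightarrow> nat) \<Rightarrow> 's option \<times> 's stack_op \<Rightarrow> nat \<Rightarrow> nat" where
  "written enc (Some y, Push x) s = enc y"
| "written enc (b, a) s = s"

text \<open>The blank 0 marks the bottom, so popping an empty stack must leave the head there, in
  accordance with \<open>tl [] = []\<close>.\<close>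

fun movement :: "'s option \<times> 's stack_op \<Rightarrow> nat \<Rightarrow> int" where
  "movement (b, Keep) s = 0"
| "movement (None, Pop) s = (if s = 0 then 0 else -1)"
| "movement (Some y, Pop) s = -1"
| "movement (b, Push x) s = 1"

lemma on_tape_upd: "h < h' \<Longrightarrow> on_tape enc (t(h' := s)) h st = on_tape enc t h st"
  by (induction st arbitrary: h) auto

lemma visible_top:
  assumes "tape_rel enc b t h st" "dec 0 = None" "\<And>x. x \<in> set st \<Longrightarrow> dec (enc x) = Some x"
  shows "visible dec b (t h) = top_of st"
  using assms by (cases b; cases st) auto

lemma tape_rel_step:
  assumes "tape_rel enc b t h st" "\<And>x. enc x \<noteq> 0"
  shows "tape_rel enc (new_buffer b a) (t(h := written enc (b, a) (t h))) (h + movement (b, a) (t h))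
           (apply_op a st)"
  using assms(1) by (cases b; cases a; cases st) (auto simp: on_tape_upd assms(2))

lemma ex_encoding:
  assumes "finite A"
  obtains f :: "'a \<Rightarrow> nat" where "inj_on f A"
  using finite_imp_inj_to_nat_seg[OF assms] by blast

text \<open>Pairs of a control state and a list of buffers are finite in number and are coded as
  states; each move of the stacks is then exactly one move of the tapes, so no delay arises.\<close>

theorem stack_machine_real_time:
  fixes \<delta> :: "'q \<Rightarrow> 'a \<Rightarrow> 's option list \<Rightarrow> 'q \<times> 's stack_op list"
  assumes fin: "finite Q" "finite \<Gamma>" and q0: "q0 \<in> Q"
    and closed: "\<And>q a ts q' acts. \<lbrakk>q \<in> Q; a \<in> \<Sigma>; length ts = k; \<And>x. Some x \<in> set ts \<Longrightarrow> x \<in> \<Gamma>;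
        \<delta> q a ts = (q', acts)\<rbrakk> \<Longrightarrow> q' \<in> Q \<and> length acts = k \<and> (\<forall>x. Push x \<in> set acts \<longrightarrow> x \<in> \<Gamma>)"
    and L: "L \<subseteq> lists \<Sigma>"
      "\<And>w. w \<in> lists \<Sigma> \<Longrightarrow> w \<in> L \<longleftrightarrow> fst (foldl (stack_step \<delta>) (q0, replicate k []) w) \<in> F"
  shows "real_time_language \<Sigma> L"
proof -
  obtain e :: "'s \<Rightarrow> nat" where e: "inj_on e \<Gamma>" using ex_encoding[OF fin(2)] .
  \<comment> \<open>The shift keeps 0 free for the blank.\<close>
  define enc where "enc x = Suc (e x)" for x
  define dec where "dec n = (if \<exists>x \<in> \<Gamma>. n = enc x then Some (inv_into \<Gamma> e (n - 1)) else None)" for n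
  have enc0: "enc x \<noteq> 0" for x by (simp add: enc_def)
  have dec0: "dec 0 = None" by (simp add: dec_def enc_def)
  have dec_enc: "dec (enc x) = Some x" if "x \<in> \<Gamma>" for x
    using that e by (auto simp: dec_def enc_def)
  have dec_in: "x \<in> \<Gamma>" if "dec n = Some x" for n x
    using that e by (auto simp: dec_def enc_def split: if_splits)
  define QQ where "QQ = Q \<times> {bs. set bs \<subseteq> insert None (Some ` \<Gamma>) \<and> length bs = k}"
  have finQQ: "finite QQ" unfolding QQ_def using fin by (intro finite_SigmaI finite_lists_length_eq) auto
  obtain g :: "'q \<times> 's option list \<Rightarrow> nat" where g: "inj_on g QQ" using ex_encoding[OF finQQ] .
  define \<delta>' where "\<delta>' n a ss = (case inv_into QQ g n of (q, bs) \<Rightarrow>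
     (case \<delta> q a (map2 (visible dec) bs ss) of (q', acts) \<Rightarrow>
       (g (q', map2 new_buffer bs acts), map2 (written enc) (zip bs acts) ss,
        map2 movement (zip bs acts) ss)))" for n a ss
  let ?Q = "g ` QQ" and ?G = "insert 0 (enc ` \<Gamma>)"
  have step: "(q', map2 new_buffer bs acts) \<in> QQ \<and> length acts = k \<and> (\<forall>x. Push x \<in> set acts \<longrightarrow> x \<in> \<Gamma>)"
    if "(q, bs) \<in> QQ" "a \<in> \<Sigma>" "length ss = k" "\<delta> q a (map2 (visible dec) bs ss) = (q', acts)"
    for q bs a ss q' acts
  proof -
    have len: "length bs = k" "q \<in> Q" and bs: "\<And>x. Some x \<in> set bs \<Longrightarrow> x \<in> \<Gamma>"
      using that(1) by (auto simp: QQ_def)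
    have "x \<in> \<Gamma>" if x: "Some x \<in> set (map2 (visible dec) bs ss)" for x
    proof -
      obtain b s where "(b, s) \<in> set (zip bs ss)" "visible dec b s = Some x" using x by (metis (no_types, lifting) imageE list.set_map prod.collapse case_prod_conv)
      then show ?thesis using bs dec_in by (cases b) (auto dest!: set_zip_leftD)
    qed
    then have c: "q' \<in> Q \<and> length acts = k \<and> (\<forall>x. Push x \<in> set acts \<longrightarrow> x \<in> \<Gamma>)"
      using closed[OF len(2) that(2) _ _ that(4)] len that(3) by auto
    have "new_buffer b a' \<in> insert None (Some ` \<Gamma>)" if "(b, a') \<in> set (zip bs acts)" for b a'
      using c bs set_zip_leftD[OF that] set_zip_rightD[OF that] by (cases a'; cases b) auto
    then show ?thesis using c len by (auto simp: QQ_def)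
  qed
  have mv: "movement ba s \<in> {-1, 0, 1}" for ba :: "'s option \<times> 's stack_op" and s
    by (cases "(ba, s)" rule: movement.cases) auto
  have closed': "case \<delta>' n a ss of (q', ws, ms) \<Rightarrow> q' \<in> ?Q \<and> length ws = k \<and> set ws \<subseteq> ?G \<and>
       length ms = k \<and> set ms \<subseteq> {-1, 0, 1}"
    if n: "n \<in> ?Q" "a \<in> \<Sigma>" "length ss = k" "set ss \<subseteq> ?G" for n a ss
  proof -
    obtain q bs where qb: "inv_into QQ g n = (q, bs)" by force
    have QQ: "(q, bs) \<in> QQ" using inv_into_into[OF n(1)] qb by simp
    obtain q' acts where d: "\<delta> q a (map2 (visible dec) bs ss) = (q', acts)" by force
    note st = step[OF QQ n(2,3) d]
    have len: "length bs = k" and bs: "\<And>x. Some x \<in> set bs \<Longrightarrow> x \<in> \<Gamma>"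
      using QQ by (auto simp: QQ_def)
    have "written enc (b, a') s \<in> ?G" if "((b, a'), s) \<in> set (zip (zip bs acts) ss)" for b a' s
    proof -
      have "s \<in> ?G" "b \<in> set bs"
        using n(4) set_zip_rightD[OF that] set_zip_leftD[OF set_zip_leftD[OF that]] by auto
      then show ?thesis using bs by (cases b; cases a') auto
    qed
    then have "set (map2 (written enc) (zip bs acts) ss) \<subseteq> ?G" by auto
    moreover have "set (map2 movement (zip bs acts) ss) \<subseteq> {-1, 0, 1}"
      using mv by (simp only: set_map image_subset_iff case_prod_beta) blast
    ultimately show ?thesis using st len n(3) by (simp add: \<delta>'_def qb d)
  qed
  define Rel where "Rel C D \<longleftrightarrow> (case C of (n, ts, hs) \<Rightarrow> case D of (q, sts) \<Rightarrow>
     \<exists>bs. (q, bs) \<in> QQ \<and> n = g (q, bs) \<and> length ts = k \<and> length hs = k \<and> length sts = k \<and>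
       (\<forall>i < k. tape_rel enc (bs ! i) (ts ! i) (hs ! i) (sts ! i) \<and> set (sts ! i) \<subseteq> \<Gamma>))"
    for C :: config and D :: "'q \<times> 's list list"
  have Rel_step: "Rel (tm_step \<delta>' C a) (stack_step \<delta> D a)" if R: "Rel C D" and a: "a \<in> \<Sigma>" for C D a
  proof -
    obtain n ts hs q sts where CD: "C = (n, ts, hs)" "D = (q, sts)" by (metis prod_cases3 surj_pair)
    obtain bs where r: "(q, bs) \<in> QQ" "n = g (q, bs)" "length ts = k" "length hs = k" "length sts = k"
      "\<And>i. i < k \<Longrightarrow> tape_rel enc (bs ! i) (ts ! i) (hs ! i) (sts ! i)"
      "\<And>i. i < k \<Longrightarrow> set (sts ! i) \<subseteq> \<Gamma>"
      using R by (auto simp: Rel_def CD)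
    have lb: "length bs = k" using r(1) by (simp add: QQ_def)
    have inv: "inv_into QQ g n = (q, bs)" using g r by simp
    let ?ss = "map2 (\<lambda>t h. t h) ts hs"
    have vis: "map2 (visible dec) bs ?ss = map top_of sts"
    proof (rule nth_equalityI)
      fix i assume "i < length (map2 (visible dec) bs ?ss)"
      then have i: "i < k" using lb r by simp
      have "visible dec (bs ! i) ((ts ! i) (hs ! i)) = top_of (sts ! i)"
        using visible_top[of enc "bs ! i" "ts ! i" "hs ! i" "sts ! i" dec] r(6,7)[OF i] dec0 dec_enc by blast
      then show "map2 (visible dec) bs ?ss ! i = map top_of sts ! i" using i lb r by simp
    qed (use lb r in simp)
    obtain q' acts where d: "\<delta> q a (map top_of sts) = (q', acts)" by force
    have ls: "length ?ss = k" using r by simp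
    note st = step[OF r(1) a ls, unfolded vis, OF d]
    have "Rel (g (q', map2 new_buffer bs acts),
       map2 (\<lambda>(t, h) s. t(h := s)) (zip ts hs) (map2 (written enc) (zip bs acts) ?ss),
       map2 (+) hs (map2 movement (zip bs acts) ?ss)) (q', map2 apply_op acts sts)"
    proof -
      have "tape_rel enc (new_buffer (bs ! i) (acts ! i))
          ((ts ! i)(hs ! i := written enc (bs ! i, acts ! i) ((ts ! i) (hs ! i))))
          (hs ! i + movement (bs ! i, acts ! i) ((ts ! i) (hs ! i))) (apply_op (acts ! i) (sts ! i))"
        if "i < k" for i
        using tape_rel_step[of enc "bs ! i" "ts ! i" "hs ! i" "sts ! i" "acts ! i"] r(6)[OF that] enc0 by blast
      moreover have "set (apply_op (acts ! i) (sts ! i)) \<subseteq> \<Gamma>" if i: "i < k" for i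
      proof -
        have "acts ! i \<in> set acts" using st i by simp
        then have "x \<in> \<Gamma>" if "acts ! i = Push x" for x using st that by simp
        then have "set_stack_op (acts ! i) \<subseteq> \<Gamma>" by (cases "acts ! i") auto
        then show ?thesis using set_apply_op[of "acts ! i" "sts ! i"] r(7)[OF i] by blast
      qed
      ultimately show ?thesis unfolding Rel_def using st lb r
        by (auto intro!: exI[of _ "map2 new_buffer bs acts"])
    qed
    then show ?thesis by (simp add: CD tm_step_def stack_step_def \<delta>'_def inv vis d)
  qed
  have Rel_run: "Rel (tm_run \<delta>' C w) (foldl (stack_step \<delta>) D w)" if "Rel C D" "w \<in> lists \<Sigma>" for C D w
    using that unfolding tm_run_def by (induction w arbitrary: C D) (auto simp: Rel_step)
  let ?n0 = "g (q0, replicate k None)"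
  have q0Q: "(q0, replicate k None) \<in> QQ" using q0 by (auto simp: QQ_def)
  then have Rel0: "Rel (?n0, replicate k (\<lambda>_. 0), replicate k 0) (q0, replicate k [])"
    unfolding Rel_def by (auto intro!: exI[of _ "replicate k None"])
  \<comment> \<open>\<open>F\<close> may reach outside \<open>Q\<close>; it is cut down to
    \<open>QQ\<close>, where \<open>g\<close> is injective.\<close>
  let ?F = "g ` {(q, bs) \<in> QQ. q \<in> F}"
  have acc: "fst C \<in> ?F \<longleftrightarrow> fst D \<in> F" if R: "Rel C D" for C D
  proof -
    obtain bs where "(fst D, bs) \<in> QQ" "fst C = g (fst D, bs)"
      using R by (auto simp: Rel_def)
    then show ?thesis using g by (auto simp: inj_on_def)
  qed
  show ?thesis unfolding real_time_language_def
  proof (rule conjI[OF L(1)], rule exI[of _ k], rule exI[of _ ?Q], rule exI[of _ ?G],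
      rule exI[of _ ?n0], rule exI[of _ ?F], rule exI[of _ \<delta>'], intro conjI)
    show "\<forall>w \<in> lists \<Sigma>. w \<in> L \<longleftrightarrow>
       fst (tm_run \<delta>' (?n0, replicate k (\<lambda>_. 0), replicate k 0) w) \<in> ?F"
      using L(2) acc[OF Rel_run[OF Rel0]] by blast
    show "\<forall>q \<in> ?Q. \<forall>a \<in> \<Sigma>. \<forall>ss. length ss = k \<longrightarrow> set ss \<subseteq> ?G \<longrightarrow>
            (case \<delta>' q a ss of (q', ws, ms) \<Rightarrow>
               q' \<in> ?Q \<and> length ws = k \<and> set ws \<subseteq> ?G \<and> length ms = k \<and> set ms \<subseteq> {-1, 0, 1})"
      by (intro ballI allI impI closed')
    show "?n0 \<in> ?Q" using q0Q by (rule imageI)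
    show "?F \<subseteq> ?Q" by (rule image_mono) auto
  qed (use fin(2) finQQ in simp_all)
qed

section \<open>Distance to a quasiconvex subgroup\<close>

locale quasiconvex_subgroup = hyperbolic +
  fixes H :: "'a set" and \<kappa> :: nat
  assumes sub: "subgroup H G"
    and qc: "\<And>w p. \<lbrakk>geodesic_word G S w; ev w \<in> H; p \<in> path_points G \<one> w\<rbrakk> \<Longrightarrow> \<exists>h \<in> H. dst p h \<le> \<kappa>"
begin

lemma H_carrier [simp]: "h \<in> H \<Longrightarrow> h \<in> carrier G"
  using subgroup.mem_carrier[OF sub] .

lemma H_closed [simp]: "\<one> \<in> H" "h \<in> H \<Longrightarrow> inv h \<in> H" "h \<in> H \<Longrightarrow> h' \<in> H \<Longrightarrow> h \<otimes> h' \<in> H"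
  using sub by (auto simp: subgroup.one_closed subgroup.m_inv_closed subgroup.m_closed)

text \<open>A point on the geodesic from 1 to \<open>h\<close> is near \<open>H\<close>, so it
  cannot be much nearer to \<open>x\<close> than 1 is. Taken far enough along, it leaves only the
  term with \<open>dst x h\<close> in the four-point inequality. A short \<open>h\<close> is
  absorbed by the constant.\<close>

lemma almost_perpendicular:
  assumes h: "h \<in> H" and x: "x \<in> carrier G" and min: "\<And>h'. h' \<in> H \<Longrightarrow> len x \<le> dst h' x + e"
  shows "len h + len x \<le> dst h x + 2 * (e + \<kappa> + (4 * \<delta> + 4)) + 1"
proof (cases "len h \<le> e + \<kappa> + (4 * \<delta> + 4)")
  case True
  have "len x \<le> len h + dst h x" using dst_triangle[of \<one> h x] h x by simp
  then show ?thesis using True by simp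
next
  case False
  obtain w where w: "w \<in> lists S" "length w = len (ev w)" "ev w = h"
    using ex_geodesic[of h] h by auto
  \<comment> \<open>One more than the total error, so that \<open>len x + dst ?p h\<close> is too
    small to satisfy the four-point inequality. The final 1 of the bound comes from here.\<close>
  define i where "i = e + \<kappa> + (4 * \<delta> + 4) + 1"
  have i: "i \<le> length w" using False w by (simp add: i_def)
  let ?p = "ev (take i w)"
  have p: "?p \<in> carrier G" using w by simp
  have "?p \<in> path_points G \<one> w" unfolding path_points_def using i l_one[OF p] by (smt (verit) mem_Collect_eq)
  then obtain h' where h': "h' \<in> H" "dst ?p h' \<le> \<kappa>"
    using qc[of w ?p] w(1,2) h unfolding geodesic_word_def w(3) by blast
  have "len x \<le> dst ?p x + (e + \<kappa>)"
    using min[OF h'(1)] dst_triangle[of h' ?p x] dst_sym[of h' ?p] h' p x by auto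
  moreover have "dst ?p h = length w - i"
    unfolding w(3)[symmetric] geodesic_take(3)[OF w(1,2) i]
    using dst_mult_right[OF p, of "ev (drop i w)"] geodesic_take(2)[OF w(1,2) i] w(1) by simp
  moreover have "len h + dst ?p x \<le> max (len ?p + dst x h) (len x + dst ?p h) + (4 * \<delta> + 4)"
    using four_point_one[of ?p x h] p x h by simp
  moreover have "len ?p = i" using geodesic_take(1)[OF w(1,2) i] .
  ultimately show ?thesis using i w dst_sym[of x h] h x unfolding i_def by auto
qed

section \<open>Chains of blocks as local geodesics that leave \<open>H\<close>\<close>

definition coset_min :: "'a \<Rightarrow> 'a" where
  "coset_min y = arg_min len (\<lambda>z. \<exists>h \<in> H. z = h \<otimes> y)"

lemma coset_min:
  shows "\<exists>h \<in> H. coset_min y = h \<otimes> y" "h \<in> H \<Longrightarrow> len (coset_min y) \<le> len (h \<otimes> y)"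
proof -
  have "\<exists>h \<in> H. \<one> \<otimes> y = h \<otimes> y" by (intro bexI[of _ \<one>]) simp_all
  from arg_min_nat_lemma[of "\<lambda>z. \<exists>h \<in> H. z = h \<otimes> y", OF this, of len]
  show "\<exists>h \<in> H. coset_min y = h \<otimes> y" "h \<in> H \<Longrightarrow> len (coset_min y) \<le> len (h \<otimes> y)"
    unfolding coset_min_def by auto
qed

lemma coset_min_closed [simp]: "y \<in> carrier G \<Longrightarrow> coset_min y \<in> carrier G"
  using coset_min(1)[of y] by auto

text \<open>\<open>None\<close> stands for an empty stack. There the subgroup itself acts as the
  preceding block, and multiplication becomes the passage to a shortest representative of
  \<open>H y\<close>.\<close>

fun combine :: "'a option \<Rightarrow> 'a \<Rightarrow> 'a" where
  "combine None y = coset_min y"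
| "combine (Some b) y = b \<otimes> y"

fun opt_len :: "'a option \<Rightarrow> nat" where
  "opt_len None = 0"
| "opt_len (Some b) = len b"

text \<open>The loss of length that two consecutive blocks are allowed; it is also the number of letters
  in one symbol of the queue.\<close>

abbreviation slack :: nat where "slack \<equiv> 9"

text \<open>For \<open>Some x\<close> this says that the Gromov product of \<open>inv x\<close> and
  \<open>y\<close> at 1 is at most \<open>slack / 2\<close>; for \<open>None\<close>, that
  \<open>y\<close> is shortest in its coset up to \<open>slack\<close>.\<close>

definition good :: "'a option \<Rightarrow> 'a \<Rightarrow> bool" where
  "good b y \<longleftrightarrow> opt_len b + len y \<le> len (combine b y) + slack"

text \<open>The constant of \<open>almost_perpendicular\<close> for
  \<open>e = slack\<close>.\<close>

definition loss :: nat where "loss = 2 * (slack + \<kappa> + (4 * \<delta> + 4)) + 1"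

text \<open>The loss is less than a quarter of a block. This excludes the wrong term in
  \<open>chain_step\<close> and leaves the factor 2 to spare in
  \<open>nonempty_chain_far\<close>.\<close>

definition block :: nat where "block = 4 * loss + 1"

fun product_up :: "'a list \<Rightarrow> 'a" where
  "product_up [] = \<one>"
| "product_up (b # st) = product_up st \<otimes> b"

fun chain :: "'a list \<Rightarrow> bool" where
  "chain [] \<longleftrightarrow> True"
| "chain (b # st) \<longleftrightarrow> b \<in> carrier G \<and> len b = block \<and> good (top_of st) b \<and> chain st"

lemma product_up_closed [simp]: "set st \<subseteq> carrier G \<Longrightarrow> product_up st \<in> carrier G"
  by (induction st) auto

lemma chain_carrier: "chain st \<Longrightarrow> set st \<subseteq> carrier G"
  by (induction st) auto

text \<open>In the four-point inequality for \<open>h\<close> and the last three vertices of the chain, the first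
  term of the maximum is too small because of the induction hypothesis.\<close>

lemma chain_step:
  assumes "h \<in> H" "chain st" "y \<in> carrier G" "good (top_of st) y"
  shows "dst h (product_up st) + len y \<le> dst h (product_up st \<otimes> y) + loss"
  using assms(2-)
proof (induction st arbitrary: y)
  case Nil
  have "len y \<le> dst h' y + slack" if "h' \<in> H" for h'
    using Nil coset_min(2)[of "inv h'" y] that by (simp add: good_def cayley_dist_def)
  from almost_perpendicular[OF assms(1) Nil(2) this]
  show ?case using assms(1) Nil dst_sym[of h \<one>] by (simp add: loss_def)
next
  case (Cons b st)
  let ?x = "product_up st"
  have c: "?x \<in> carrier G" "b \<in> carrier G" "h \<in> carrier G"
    using Cons chain_carrier assms(1) by auto
  have "dst h ?x + block \<le> dst h (?x \<otimes> b) + loss" using Cons.IH[of b] Cons.prems by simp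
  moreover have "dst h (?x \<otimes> b) + dst ?x (?x \<otimes> b \<otimes> y)
     \<le> max (dst h ?x + dst (?x \<otimes> b \<otimes> y) (?x \<otimes> b)) (dst h (?x \<otimes> b \<otimes> y) + dst ?x (?x \<otimes> b)) + (4 * \<delta> + 4)"
    using four_point[of h ?x "?x \<otimes> b" "?x \<otimes> b \<otimes> y"] c Cons.prems by simp
  moreover have "dst ?x (?x \<otimes> b \<otimes> y) = len (b \<otimes> y)" "dst ?x (?x \<otimes> b) = block"
      "dst (?x \<otimes> b \<otimes> y) (?x \<otimes> b) = len y"
    using c Cons.prems dst_sym[of "?x \<otimes> b \<otimes> y" "?x \<otimes> b"] dst_mult_right[of "?x \<otimes> b" y]
    by (simp_all only: dst_mult_right m_assoc m_closed chain.simps)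
  moreover have "block + len y \<le> len (b \<otimes> y) + slack" using Cons.prems by (simp add: good_def)
  ultimately show ?case by (auto simp: loss_def block_def)
qed

lemma chain_far:
  assumes "h \<in> H" "chain st"
  shows "length st * block \<le> dst h (product_up st) + length st * loss"
  using assms(2)
proof (induction st)
  case (Cons b st)
  then show ?case using chain_step[OF assms(1), of st b] by simp
qed simp

text \<open>Four times the progress of a block exceeds twice its length by at least
  \<open>4 * loss + 2\<close>, so a single block already pays for the \<open>4 * loss\<close> that
  \<open>y\<close> may cost. This puts the potential of a settled configuration below four times its
  distance from \<open>H\<close>.\<close>

lemma nonempty_chain_far:
  assumes "h \<in> H" "chain st" "st \<noteq> []" "y \<in> carrier G" "good (top_of st) y"
  shows "2 * (block * length st + len y) < 4 * dst h (product_up st \<otimes> y)"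
proof -
  obtain n where n: "length st = Suc n" using assms(3) by (cases st) auto
  show ?thesis
    using chain_far[OF assms(1,2)] chain_step[OF assms(1,2,4,5)]
    by (simp add: n block_def algebra_simps)
qed

end

section \<open>The machine for the generalised word problem\<close>

datatype mode = Bottom | Settled | Busy

context quasiconvex_subgroup
begin

text \<open>On \<open>td\<close> the top is the leftmost factor, as it is multiplied next to the
  right of the active element; on the other stacks the top is the rightmost factor.\<close>

fun product_down :: "'a list \<Rightarrow> 'a" where
  "product_down [] = \<one>"
| "product_down (t # td) = t \<otimes> product_down td"

lemma product_down_closed [simp]: "set td \<subseteq> carrier G \<Longrightarrow> product_down td \<in> carrier G"
  by (induction td) auto

text \<open>The active element lives in the finite control and is therefore capped; the excess
  becomes the first of the pending pieces.\<close>

definition reduce :: "'a option \<Rightarrow> 'a \<Rightarrow> 'a \<times> 'a stack_op" where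
  "reduce b y = (let z = combine b y in
     if len z \<le> 3 * block then (z, Keep) else (pre (3 * block) z, Push (suf (3 * block) z)))"

text \<open>Letters are bundled so that the queue grows only once in \<open>slack\<close> steps,
  whereas a cascade makes a move in every step.\<close>

fun chunk :: "'a \<Rightarrow> nat \<Rightarrow> 'a \<Rightarrow> 'a \<times> nat \<times> 'a stack_op" where
  "chunk c j s = (if Suc j = slack then (\<one>, 0, Push (c \<otimes> s)) else (c \<otimes> s, Suc j, Keep))"

text \<open>The move for an empty queue, where the leftover \<open>c\<close> and the new letter are
  multiplied in at once. Over an empty stack \<open>coset_min\<close> completes the repair, so a
  cascade starts only above a block.\<close>

fun direct_move :: "'a option \<Rightarrow> 'a \<Rightarrow> mode \<times> 'a \<times> 'a stack_op \<times> 'a stack_op" where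
  "direct_move b z =
     (if good b z then
        if 2 * block \<le> len z then (Settled, suf block z, Push (pre block z), Keep)
        else (if b = None then Bottom else Settled, z, Keep, Keep)
      else if b = None then (Bottom, coset_min z, Keep, Keep)
      else case reduce b z of (z', a) \<Rightarrow> (Busy, z', Pop, a))"

text \<open>The last component tells whether the two queue stacks exchange their roles.\<close>

fun busy_move :: "'a option \<Rightarrow> 'a option \<Rightarrow> 'a option \<Rightarrow> 'a \<Rightarrow>
    'a \<times> 'a stack_op \<times> 'a stack_op \<times> 'a stack_op \<times> bool" where
  "busy_move b t (Some x) y = (y, Keep, Push x, Pop, False)"
| "busy_move b t None y =
     (if \<not> good b y then case reduce b y of (z, a) \<Rightarrow> (z, Pop, a, Keep, False)
      else case t of
        Some u \<Rightarrow> if block \<le> len y then (suf block y \<otimes> u, Push (pre block y), Pop, Keep, False)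
                  else (y \<otimes> u, Keep, Pop, Keep, False)
      | None \<Rightarrow> (y, Keep, Keep, Keep, True))"

text \<open>There are four stacks: the blocks \<open>st\<close>, the pieces \<open>td\<close> to be multiplied next, and two halves
  \<open>tr\<close> and \<open>inp\<close> of a queue, both with the newest chunk on top. New chunks go to \<open>inp\<close>, while \<open>tr\<close>
  is being reversed onto \<open>td\<close>; the flag \<open>f\<close> tells which tape is which. The state also holds the
  active element \<open>y\<close> and the current chunk \<open>c\<close> of \<open>j\<close> letters.\<close>

type_synonym 'x state = "mode \<times> bool \<times> 'x \<times> 'x \<times> nat"

fun delta :: "'a state \<Rightarrow> 'a \<Rightarrow> 'a option list \<Rightarrow> 'a state \<times> 'a stack_op list" where
  "delta (m, f, y, c, j) s ts =
     (let b = ts ! 0; t = ts ! 1; r = ts ! (if f then 2 else 3); i = ts ! (if f then 3 else 2) in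
      if t = None \<and> r = None \<and> i = None then
        case direct_move b (y \<otimes> c \<otimes> s) of (m', z, a0, a1) \<Rightarrow> ((m', f, z, \<one>, 0), [a0, a1, Keep, Keep])
      else case busy_move b t r y of (z, a0, a1, ar, swap) \<Rightarrow>
        case chunk c j s of (c', j', ai) \<Rightarrow>
          ((Busy, f \<noteq> swap, z, c', j'), [a0, a1] @ (if f then [ar, ai] else [ai, ar])))"

text \<open>In a state, \<open>c\<close> is a product of \<open>j\<close> letters, whence the bound on its length.\<close>

definition states :: "'a state set" where
  "states = {(m, f, y, c, j). y \<in> carrier G \<and> len y \<le> 3 * block \<and> c \<in> carrier G \<and> len c \<le> j \<and> j < slack}"

definition symbols :: "'a set" where
  "symbols = {g \<in> carrier G. len g \<le> block}"

lemma finite_states_symbols: "finite states" "finite symbols"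
proof -
  have "finite (UNIV :: mode set)"
    by (rule finite_subset[of _ "{Bottom, Settled, Busy}"]) (auto intro: mode.exhaust)
  then have "finite ((UNIV :: mode set) \<times> (UNIV :: bool set) \<times> {y \<in> carrier G. len y \<le> 3 * block} \<times>
     {c \<in> carrier G. len c \<le> slack} \<times> {..<slack})"
    by (intro finite_SigmaI finite_ball) auto
  then show "finite states" by (rule rev_finite_subset) (auto simp: states_def)
  show "finite symbols" unfolding symbols_def by (rule finite_ball)
qed

section \<open>Bounds that keep the control and the stack alphabet finite\<close>

lemma slack_le_block: "slack \<le> block"
  by (simp add: block_def loss_def)

lemma combine_closed [simp]:
  "y \<in> carrier G \<Longrightarrow> (\<And>x. b = Some x \<Longrightarrow> x \<in> carrier G) \<Longrightarrow> combine b y \<in> carrier G"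
  by (cases b) auto

text \<open>The failure of \<open>good\<close> gives back the \<open>slack\<close> by which
  \<open>y\<close> may exceed \<open>3 * block\<close>. The product thus has length at most
  \<open>4 * block\<close>, and the piece cut off fits into a stack symbol.\<close>

lemma reduce_closed:
  assumes "reduce b y = (z, a)" "\<not> good b y" "y \<in> carrier G" "len y \<le> 3 * block + slack"
    "\<And>x. b = Some x \<Longrightarrow> x \<in> symbols"
  shows "z \<in> carrier G" "len z \<le> 3 * block" "\<And>x. a = Push x \<Longrightarrow> x \<in> symbols"
proof -
  let ?z = "combine b y"
  have c: "?z \<in> carrier G" using assms(3,5) by (auto simp: symbols_def)
  have "opt_len b \<le> block" using assms(5) by (cases b) (auto simp: symbols_def)
  then have "len ?z \<le> 4 * block" using assms(2,4) by (auto simp: good_def)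
  then show "z \<in> carrier G" "len z \<le> 3 * block" "\<And>x. a = Push x \<Longrightarrow> x \<in> symbols"
    using assms(1) c pre_suf[of ?z "3 * block"]
    by (auto simp: reduce_def Let_def symbols_def split: if_splits)
qed

lemma direct_move_closed:
  assumes "direct_move b z = (m', z', a0, a1)" "z \<in> carrier G" "len z \<le> 3 * block + slack"
    "\<And>x. b = Some x \<Longrightarrow> x \<in> symbols"
  shows "z' \<in> carrier G \<and> len z' \<le> 3 * block \<and> (\<forall>x. Push x \<in> {a0, a1} \<longrightarrow> x \<in> symbols)"
proof (cases "good b z")
  case True
  show ?thesis
  proof (cases "2 * block \<le> len z")
    case long: True
    then have "m' = Settled" "z' = suf block z" "a0 = Push (pre block z)" "a1 = Keep"
      using True assms(1) by simp_all
    then show ?thesis using pre_suf(1-4)[of z block] long assms(2,3) slack_le_block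
      by (simp add: symbols_def)
  next
    case False
    then have "z' = z" "a0 = Keep" "a1 = Keep" using True assms(1) by simp_all
    then show ?thesis using False assms(2) by simp
  qed
next
  case False
  show ?thesis
  proof (cases b)
    case None
    then have "len (coset_min z) + slack < len z" using False by (simp add: good_def)
    then show ?thesis using False None assms by auto
  next
    case (Some x)
    obtain y a where r: "reduce b z = (y, a)" by force
    from reduce_closed[OF r False assms(2,3)] assms(4)
    have "y \<in> carrier G" "len y \<le> 3 * block" "\<And>x. a = Push x \<Longrightarrow> x \<in> symbols" by blast+
    moreover have "z' = y" "a0 = Pop" "a1 = a" using assms(1) False Some r by simp_all
    ultimately show ?thesis by auto
  qed
qed

text \<open>A piece has length at most \<open>block\<close>: it is absorbed either after a block has
  left the active element or when that element is itself shorter than a block.\<close>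

lemma busy_move_closed:
  assumes "busy_move b t r y = (z, a0, a1, ar, swap)" "y \<in> carrier G" "len y \<le> 3 * block"
    "\<And>x. b = Some x \<or> t = Some x \<or> r = Some x \<Longrightarrow> x \<in> symbols"
  shows "z \<in> carrier G \<and> len z \<le> 3 * block \<and> (\<forall>x. Push x \<in> {a0, a1, ar} \<longrightarrow> x \<in> symbols)"
proof (cases r)
  case (Some x)
  then show ?thesis using assms by auto
next
  case None
  show ?thesis
  proof (cases "good b y")
    case False
    obtain z' a where r: "reduce b y = (z', a)" by force
    have "len y \<le> 3 * block + slack" using assms(3) by simp
    from reduce_closed[OF r False assms(2) this] assms(4)
    have "z' \<in> carrier G" "len z' \<le> 3 * block" "\<And>x. a = Push x \<Longrightarrow> x \<in> symbols" by blast+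
    moreover have "z = z'" "a0 = Pop" "a1 = a" "ar = Keep" using assms(1) None False r by simp_all
    ultimately show ?thesis by auto
  next
    case True
    show ?thesis
    proof (cases t)
      case (Some u)
      then have u: "u \<in> carrier G" "len u \<le> block" using assms(4) by (auto simp: symbols_def)
      show ?thesis
      proof (cases "block \<le> len y")
        case True
        then have "z = suf block y \<otimes> u" "a0 = Push (pre block y)" "a1 = Pop" "ar = Keep"
          using \<open>good b y\<close> Some None assms(1) by simp_all
        then show ?thesis using True assms(2,3) u pre_suf(1-4)[of y block]
            len_mult[of "suf block y" u] by (simp add: symbols_def)
      next
        case False
        then show ?thesis using \<open>good b y\<close> Some None assms(1-3) u len_mult[of y u] by auto
      qed
    qed (use True None assms in auto)
  qed
qed

lemma delta_closed:
  assumes q: "q \<in> states" and s: "s \<in> S" and ts: "length ts = 4" "\<And>x. Some x \<in> set ts \<Longrightarrow> x \<in> symbols"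
    and d: "delta q s ts = (q', acts)"
  shows "q' \<in> states \<and> length acts = 4 \<and> (\<forall>x. Push x \<in> set acts \<longrightarrow> x \<in> symbols)"
proof -
  obtain m f y c j where q_def: "q = (m, f, y, c, j)" by (metis prod_cases5)
  have c: "y \<in> carrier G" "len y \<le> 3 * block" "c \<in> carrier G" "len c \<le> j" "j < slack"
      "s \<in> carrier G" "len s \<le> 1"
    using q s len_gen by (auto simp: q_def states_def S_carrier)
  define b t r i where "b = ts ! 0" and "t = ts ! 1" and "r = ts ! (if f then 2 else 3)"
    and "i = ts ! (if f then 3 else 2)"
  have in_ts: "ts ! n \<in> set ts" if "n < 4" for n using that ts by simp
  have sym: "\<And>x. b = Some x \<or> t = Some x \<or> r = Some x \<Longrightarrow> x \<in> symbols"
    using ts(2) in_ts[of 0] in_ts[of 1] in_ts[of 2] in_ts[of 3]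
    by (auto simp: b_def t_def r_def split: if_splits)
  show ?thesis
  proof (cases "t = None \<and> r = None \<and> i = None")
    case True
    obtain m' z a0 a1 where mv: "direct_move b (y \<otimes> c \<otimes> s) = (m', z, a0, a1)" by (metis prod_cases4)
    have "len (y \<otimes> c \<otimes> s) \<le> 3 * block + slack"
      using len_mult[of "y \<otimes> c" s] len_mult[of y c] c by auto
    then have "z \<in> carrier G \<and> len z \<le> 3 * block \<and> (\<forall>x. Push x \<in> {a0, a1} \<longrightarrow> x \<in> symbols)"
      using direct_move_closed[OF mv] c sym by auto
    moreover have "q' = (m', f, z, \<one>, 0)" "acts = [a0, a1, Keep, Keep]"
      using d True mv by (simp_all add: q_def b_def t_def r_def i_def Let_def split: if_splits)
    ultimately show ?thesis by (auto simp: states_def)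
  next
    case False
    obtain z a0 a1 ar swap where mv: "busy_move b t r y = (z, a0, a1, ar, swap)" by (metis prod_cases5)
    obtain c' j' ai where ch: "chunk c j s = (c', j', ai)" by (metis prod_cases3)
    have qa: "q' = (Busy, f \<noteq> swap, z, c', j')" "acts = [a0, a1] @ (if f then [ar, ai] else [ai, ar])"
      using d False mv ch
      by (simp_all add: q_def b_def t_def r_def i_def Let_def del: chunk.simps split: if_splits)
    have "c' \<in> carrier G \<and> len c' \<le> j' \<and> j' < slack \<and> (\<forall>x. ai = Push x \<longrightarrow> x \<in> symbols)"
      using ch c len_mult[of c s] slack_le_block by (auto simp: symbols_def split: if_splits)
    then show ?thesis using busy_move_closed[OF mv c(1,2) sym] qa
      by (auto simp: states_def)
  qed
qed

end

section \<open>The invariant\<close>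

context quasiconvex_subgroup
begin

text \<open>\<open>tr\<close> stands to the left of \<open>td\<close> because its top, the newest
  chunk in it, is the next to land on \<open>td\<close>.\<close>

definition total :: "'a \<Rightarrow> 'a \<Rightarrow> 'a list \<Rightarrow> 'a list \<Rightarrow> 'a list \<Rightarrow> 'a list \<Rightarrow> 'a" where
  "total y c st td tr inp =
     product_up st \<otimes> (y \<otimes> (product_up tr \<otimes> (product_down td \<otimes> (product_up inp \<otimes> c))))"

text \<open>The weights are such that a step of a cascade lowers the potential by \<open>slack\<close>, whereas the letter
  read in that step raises it by at most 5; four times the distance to \<open>H\<close> changes by at most 4.\<close>

definition potential :: "'a \<Rightarrow> nat \<Rightarrow> 'a list \<Rightarrow> 'a list \<Rightarrow> 'a list \<Rightarrow> 'a list \<Rightarrow> nat" where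
  "potential y j st td tr inp = 2 * (block * length st + len y + sum_list (map len td)) +
     slack * (length td + 4 * length tr + 5 * length inp) + 5 * j"

definition valid :: "'a \<Rightarrow> 'a \<Rightarrow> nat \<Rightarrow> 'a list \<Rightarrow> 'a list \<Rightarrow> 'a list \<Rightarrow> 'a list \<Rightarrow> bool" where
  "valid y c j st td tr inp \<longleftrightarrow> chain st \<and> set td \<subseteq> carrier G \<and>
     set tr \<subseteq> {x \<in> carrier G. len x \<le> slack} \<and> set inp \<subseteq> {x \<in> carrier G. len x \<le> slack} \<and>
     y \<in> carrier G \<and> c \<in> carrier G \<and> len c \<le> j \<and> j < slack"

text \<open>Outside \<open>Bottom\<close> the strict inequality makes the distance from
  \<open>H\<close> positive, which justifies rejection even while the product is not in reduced
  form. In \<open>Bottom\<close> the coset of \<open>g\<close> is known from \<open>y\<close>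
  alone.\<close>

definition invariant :: "'a \<Rightarrow> mode \<Rightarrow> 'a \<Rightarrow> 'a \<Rightarrow> nat \<Rightarrow> 'a list \<Rightarrow> 'a list \<Rightarrow> 'a list \<Rightarrow> 'a list \<Rightarrow> bool" where
  "invariant g m y c j st td tr inp \<longleftrightarrow> valid y c j st td tr inp \<and>
     (\<exists>h \<in> H. g = h \<otimes> total y c st td tr inp) \<and>
     (m = Bottom \<longrightarrow> st = [] \<and> td = [] \<and> tr = [] \<and> inp = [] \<and> c = \<one>) \<and>
     (m \<noteq> Bottom \<longrightarrow> (\<forall>h \<in> H. potential y j st td tr inp < 4 * dst h g))"

section \<open>The effect of single moves on the product and on the potential\<close>

lemma product_down_append:
  "set ds \<subseteq> carrier G \<Longrightarrow> set td \<subseteq> carrier G \<Longrightarrow>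
    product_down (ds @ td) = product_down ds \<otimes> product_down td"
  by (induction ds) (auto simp: m_assoc)

lemma valid_closed:
  assumes "valid y c j st td tr inp"
  shows "set st \<subseteq> carrier G" "set td \<subseteq> carrier G" "set tr \<subseteq> carrier G" "set inp \<subseteq> carrier G"
    "y \<in> carrier G" "c \<in> carrier G"
  using assms chain_carrier by (auto simp: valid_def)

lemma total_closed: "valid y c j st td tr inp \<Longrightarrow> total y c st td tr inp \<in> carrier G"
  using valid_closed by (simp add: total_def)

text \<open>Above a block the product is only regrouped and \<open>h\<close> is 1; over an empty
  stack \<open>h\<close> comes from \<open>coset_min\<close>. The gain in length is the failure of
  \<open>good\<close>. The list \<open>ds\<close> treats both outcomes of \<open>reduce\<close> at
  once.\<close>

lemma reduce_step:
  assumes st: "chain st" and y: "y \<in> carrier G" and bad: "\<not> good (top_of st) y"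
    and red: "reduce (top_of st) y = (z, a)"
  obtains h ds where "h \<in> H" "\<And>td. apply_op a td = ds @ td" "set ds \<subseteq> carrier G" "length ds \<le> 1"
    "z \<in> carrier G" "product_up (tl st) \<otimes> (z \<otimes> product_down ds) = h \<otimes> (product_up st \<otimes> y)"
    "block * length (tl st) + len z + sum_list (map len ds) + slack < block * length st + len y"
proof -
  let ?z = "combine (top_of st) y"
  have top: "x \<in> carrier G" if "top_of st = Some x" for x
    using top_of_in_set[OF that] chain_carrier[OF st] by auto
  have z: "?z \<in> carrier G" using y top by simp
  obtain ds where ds: "\<And>td. apply_op a td = ds @ td" "set ds \<subseteq> carrier G" "length ds \<le> 1"
    "z \<in> carrier G" "z \<otimes> product_down ds = ?z" "len z + sum_list (map len ds) = len ?z"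
  proof (cases "len ?z \<le> 3 * block")
    case True
    then have "z = ?z" "a = Keep" using red by (simp_all add: reduce_def)
    then show thesis using z by (intro that[of "[]"]) simp_all
  next
    case False
    then have za: "z = pre (3 * block) ?z" "a = Push (suf (3 * block) ?z)"
      using red by (simp_all add: reduce_def Let_def)
    from False have "3 * block \<le> len ?z" by simp
    note ps = pre_suf[OF z this]
    show thesis
    proof (rule that[of "[suf (3 * block) ?z]"])
      show "z \<otimes> product_down [suf (3 * block) ?z] = ?z" using ps za by simp
      show "len z + sum_list (map len [suf (3 * block) ?z]) = len ?z"
        using ps(2,4) za False by simp
    qed (use ps za in simp_all)
  qed
  obtain h where h: "h \<in> H" "product_up (tl st) \<otimes> ?z = h \<otimes> (product_up st \<otimes> y)"
  proof (cases st)
    case Nil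
    then show thesis using coset_min(1)[of y] y that by auto
  next
    case (Cons b st')
    then show thesis using st y chain_carrier[of st'] by (intro that[of \<one>]) (simp_all add: m_assoc)
  qed
  have "block * length (tl st) + len ?z + slack < block * length st + len y"
    using bad st by (cases st) (auto simp: good_def)
  then show thesis using h ds by (intro that[of h ds]) (simp_all add: add.assoc)
qed

text \<open>Closing a chunk trades \<open>5 * (slack - 1)\<close> for \<open>5 * slack\<close>, so
  it raises the potential by 5 like any other letter.\<close>

lemma chunk_step:
  assumes v: "valid y c j st td tr inp" and s: "s \<in> S" and ch: "chunk c j s = (c', j', a)"
  shows "valid y c' j' st td tr (apply_op a inp)"
    "total y c' st td tr (apply_op a inp) = total y c st td tr inp \<otimes> s"
    "potential y j' st td tr (apply_op a inp) \<le> potential y j st td tr inp + 5"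
    "inp \<noteq> [] \<Longrightarrow> apply_op a inp \<noteq> []"
proof -
  note c = valid_closed[OF v]
  have s': "s \<in> carrier G" using s by (rule S_carrier)
  have l: "len (c \<otimes> s) \<le> Suc j" using len_mult[OF c(6) s'] len_gen[OF s] v by (simp add: valid_def)
  have "(valid y c' j' st td tr (apply_op a inp) \<and>
    total y c' st td tr (apply_op a inp) = total y c st td tr inp \<otimes> s) \<and>
    potential y j' st td tr (apply_op a inp) \<le> potential y j st td tr inp + 5 \<and>
    (inp \<noteq> [] \<longrightarrow> apply_op a inp \<noteq> [])"
  proof (cases "Suc j = slack")
    case True
    then have "c' = \<one>" "j' = 0" "a = Push (c \<otimes> s)" using ch by simp_all
    then show ?thesis using v c s' l True by (simp add: valid_def total_def potential_def m_assoc)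
  next
    case False
    then have "c' = c \<otimes> s" "j' = Suc j" "a = Keep" using ch by simp_all
    then show ?thesis using v c s' l False by (simp add: valid_def total_def potential_def m_assoc)
  qed
  then show "valid y c' j' st td tr (apply_op a inp)"
    "total y c' st td tr (apply_op a inp) = total y c st td tr inp \<otimes> s"
    "potential y j' st td tr (apply_op a inp) \<le> potential y j st td tr inp + 5"
    "inp \<noteq> [] \<Longrightarrow> apply_op a inp \<noteq> []"
    by simp_all
qed

text \<open>Dropping \<open>suf m y\<close> shortens \<open>y\<close> by exactly the length of the
  suffix, and the combined element by at most that. Over an empty stack, the shortest representative
  for the prefix times the suffix lies in \<open>H y\<close>.\<close>

lemma good_pre:
  assumes b: "\<And>x. b = Some x \<Longrightarrow> x \<in> carrier G" and y: "y \<in> carrier G" "m \<le> len y" "good b y"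
  shows "good b (pre m y)"
proof (cases b)
  case None
  note p = pre_suf[OF y(1,2)]
  obtain h where h: "h \<in> H" "coset_min (pre m y) = h \<otimes> pre m y" using coset_min(1) by blast
  have "len (coset_min y) \<le> len (h \<otimes> y)" using coset_min(2)[OF h(1)] .
  also have "h \<otimes> y = (h \<otimes> pre m y) \<otimes> suf m y" using p h(1) by (simp add: m_assoc)
  also have "len \<dots> \<le> len (h \<otimes> pre m y) + len (suf m y)" using p h(1) by (intro len_mult) simp_all
  finally show ?thesis using y p(2,4) None h(2) by (simp add: good_def)
next
  case (Some x)
  note p = pre_suf[OF y(1,2)]
  have "x \<otimes> y = (x \<otimes> pre m y) \<otimes> suf m y" using p b Some by (simp add: m_assoc)
  then have "len (x \<otimes> y) \<le> len (x \<otimes> pre m y) + len (suf m y)"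
    using p(1,3) b Some len_mult[of "x \<otimes> pre m y" "suf m y"] by simp
  then show ?thesis using y p(2,4) Some by (simp add: good_def)
qed

lemma good_pre_suf:
  assumes "y \<in> carrier G" "m \<le> len y"
  shows "good (Some (pre m y)) (suf m y)"
  using pre_suf[OF assms] assms by (simp add: good_def)

lemma push_step:
  assumes "chain st" "y \<in> carrier G" "block \<le> len y" "good (top_of st) y"
  shows "chain (pre block y # st)"
    "product_up (pre block y # st) \<otimes> suf block y = product_up st \<otimes> y"
    "block * length (pre block y # st) + len (suf block y) = block * length st + len y"
proof -
  note p = pre_suf[OF assms(2,3)]
  have st: "set st \<subseteq> carrier G" using chain_carrier[OF assms(1)] .
  have "x \<in> carrier G" if "top_of st = Some x" for x
    using subsetD[OF st top_of_in_set[OF that]] .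
  then have "good (top_of st) (pre block y)"
    by (rule good_pre[OF _ assms(2,3,4)])
  then show "chain (pre block y # st)" using p assms(1) by simp
  show "product_up (pre block y # st) \<otimes> suf block y = product_up st \<otimes> y"
    using p st by (simp add: m_assoc)
  show "block * length (pre block y # st) + len (suf block y) = block * length st + len y"
    using p(4) assms(3) by simp
qed

lemma busy_step:
  assumes v: "valid y c j st td tr inp" and ne: "\<not> (td = [] \<and> tr = [] \<and> inp = [])"
    and mv: "busy_move (top_of st) (top_of td) (top_of tr) y = (z, a0, a1, ar, swap)"
  defines "tr' \<equiv> if swap then inp else apply_op ar tr"
    and "inp' \<equiv> if swap then apply_op ar tr else inp"
  shows "valid z c j (apply_op a0 st) (apply_op a1 td) tr' inp' \<and>
    (\<exists>h \<in> H. total z c (apply_op a0 st) (apply_op a1 td) tr' inp' = h \<otimes> total y c st td tr inp) \<and>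
    potential z j (apply_op a0 st) (apply_op a1 td) tr' inp' + slack \<le> potential y j st td tr inp"
proof -
  note c = valid_closed[OF v]
  have one: "\<exists>h \<in> H. total y c st td tr inp = h \<otimes> total y c st td tr inp"
    using total_closed[OF v] by (intro bexI[of _ \<one>]) simp_all
  consider (transfer) x tr0 where "tr = x # tr0"
    | (bad) "tr = []" "\<not> good (top_of st) y"
    | (good) u td0 where "tr = []" "good (top_of st) y" "td = u # td0"
    | (swap) "tr = []" "td = []" "good (top_of st) y"
    by (metis neq_Nil_conv)
  then show ?thesis
  proof cases
    \<comment> \<open>A chunk of weight \<open>4 * slack\<close> becomes a piece of weight at most
      \<open>2 * slack + slack\<close>.\<close>
    case transfer
    then have e: "z = y" "a0 = Keep" "a1 = Push x" "ar = Pop" "swap = False" using mv by simp_all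
    have x: "x \<in> carrier G" "len x \<le> slack" using v transfer by (simp_all add: valid_def)
    have "total y c st (x # td) tr0 inp = total y c st td tr inp"
      using c transfer by (simp add: total_def m_assoc)
    then have "\<exists>h \<in> H. total z c (apply_op a0 st) (apply_op a1 td) tr' inp' = h \<otimes> total y c st td tr inp"
      using one e transfer by (simp add: tr'_def inp'_def)
    moreover have "valid z c j (apply_op a0 st) (apply_op a1 td) tr' inp'"
      using v e transfer by (simp add: tr'_def inp'_def valid_def)
    moreover have "potential z j (apply_op a0 st) (apply_op a1 td) tr' inp' + slack \<le> potential y j st td tr inp"
      using e transfer x by (simp add: tr'_def inp'_def potential_def)
    ultimately show ?thesis by blast
  next
    \<comment> \<open>The repair gains more than \<open>2 * slack\<close>, and at most one new piece
      costs \<open>slack\<close>.\<close>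
    case bad
    obtain w a where red: "reduce (top_of st) y = (w, a)" by force
    then have e: "z = w" "a0 = Pop" "a1 = a" "ar = Keep" "swap = False" using mv bad by simp_all
    have ch: "chain st" using v by (simp add: valid_def)
    obtain h ds where r: "h \<in> H" "\<And>td. apply_op a td = ds @ td" "set ds \<subseteq> carrier G" "length ds \<le> 1"
      "z \<in> carrier G" "product_up (tl st) \<otimes> (z \<otimes> product_down ds) = h \<otimes> (product_up st \<otimes> y)"
      "block * length (tl st) + len z + sum_list (map len ds) + slack < block * length st + len y"
      using reduce_step[OF ch c(5) bad(2) red] unfolding e(1)[symmetric] by metis
    have ch': "chain (tl st)" using ch by (cases st) simp_all
    have tl: "set (tl st) \<subseteq> carrier G" using chain_carrier[OF ch'] .
    let ?r = "product_down td \<otimes> (product_up inp \<otimes> c)"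
    have "total z c (tl st) (ds @ td) [] inp = (product_up (tl st) \<otimes> (z \<otimes> product_down ds)) \<otimes> ?r"
      using c r(3,5) tl by (simp add: total_def product_down_append m_assoc)
    also have "\<dots> = h \<otimes> total y c st td tr inp"
      unfolding r(6) using c r(1) bad(1) by (simp add: total_def m_assoc)
    finally have "\<exists>h \<in> H. total z c (apply_op a0 st) (apply_op a1 td) tr' inp' = h \<otimes> total y c st td tr inp"
      using r(1,2) e bad(1) by (auto simp: tr'_def inp'_def)
    moreover have "valid z c j (apply_op a0 st) (apply_op a1 td) tr' inp'"
      using v e bad(1) r(2,3,5) ch' by (simp add: tr'_def inp'_def valid_def)
    moreover have "potential z j (apply_op a0 st) (apply_op a1 td) tr' inp' + slack \<le> potential y j st td tr inp"
      using e bad(1) r(2,4,7) by (simp add: tr'_def inp'_def potential_def)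
    ultimately show ?thesis by blast
  next
    \<comment> \<open>The total length does not grow, and one piece of weight \<open>slack\<close>
      disappears.\<close>
    case good
    have u: "u \<in> carrier G" using c(2) good(3) by simp
    have ch: "chain st" using v by (simp add: valid_def)
    show ?thesis
    proof (cases "block \<le> len y")
      case True
      have e: "z = suf block y \<otimes> u" "a0 = Push (pre block y)" "a1 = Pop" "ar = Keep" "swap = False"
        using mv good True by simp_all
      note p = push_step[OF ch c(5) True good(2)]
      note ps = pre_suf[OF c(5) True]
      let ?p = "pre block y" and ?s = "suf block y" and ?r = "product_down td0 \<otimes> (product_up inp \<otimes> c)"
      have "total z c (?p # st) td0 [] inp = (product_up (?p # st) \<otimes> ?s) \<otimes> (u \<otimes> ?r)"
        using c ps(1,3) u good(3) unfolding e by (simp add: total_def m_assoc)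
      also have "\<dots> = total y c st td tr inp"
        unfolding p(2) using c u good(1,3) by (simp add: total_def m_assoc)
      finally have "\<exists>h \<in> H. total z c (apply_op a0 st) (apply_op a1 td) tr' inp' = h \<otimes> total y c st td tr inp"
        using one e good by (simp add: tr'_def inp'_def)
      moreover have "valid z c j (apply_op a0 st) (apply_op a1 td) tr' inp'"
        using v e good p(1) ps(1,3) u by (simp add: tr'_def inp'_def valid_def)
      moreover have "potential z j (apply_op a0 st) (apply_op a1 td) tr' inp' + slack \<le> potential y j st td tr inp"
        using e good p(3) len_mult[OF ps(3) u] by (simp add: tr'_def inp'_def potential_def)
      ultimately show ?thesis by blast
    next
      case False
      have e: "z = y \<otimes> u" "a0 = Keep" "a1 = Pop" "ar = Keep" "swap = False"
        using mv good False by simp_all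
      have "total z c st td0 [] inp = total y c st td tr inp"
        unfolding e using c u good(1,3) by (simp add: total_def m_assoc)
      then have "\<exists>h \<in> H. total z c (apply_op a0 st) (apply_op a1 td) tr' inp' = h \<otimes> total y c st td tr inp"
        using one e good by (simp add: tr'_def inp'_def)
      moreover have "valid z c j (apply_op a0 st) (apply_op a1 td) tr' inp'"
        using v e good u by (simp add: tr'_def inp'_def valid_def)
      moreover have "potential z j (apply_op a0 st) (apply_op a1 td) tr' inp' + slack \<le> potential y j st td tr inp"
        using e good len_mult[OF c(5) u] by (simp add: tr'_def inp'_def potential_def)
      ultimately show ?thesis by blast
    qed
  next
    \<comment> \<open>Each chunk drops from weight \<open>5 * slack\<close> to
      \<open>4 * slack\<close>; \<open>ne\<close> guarantees that there is one.\<close>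
    case swap
    then have e: "z = y" "a0 = Keep" "a1 = Keep" "ar = Keep" "swap = True" using mv by simp_all
    have "total y c st [] inp [] = total y c st td tr inp"
      using c swap by (simp add: total_def)
    then have "\<exists>h \<in> H. total z c (apply_op a0 st) (apply_op a1 td) tr' inp' = h \<otimes> total y c st td tr inp"
      using one e swap by (simp add: tr'_def inp'_def)
    moreover have "valid z c j (apply_op a0 st) (apply_op a1 td) tr' inp'"
      using v e swap by (simp add: tr'_def inp'_def valid_def)
    moreover have "potential z j (apply_op a0 st) (apply_op a1 td) tr' inp' + slack \<le> potential y j st td tr inp"
      using e swap ne by (cases inp) (simp_all add: tr'_def inp'_def potential_def)
    ultimately show ?thesis by blast
  qed
qed

section \<open>Preservation of the invariant\<close>

lemma dst_drop:
  assumes "h \<in> H" "g \<in> carrier G" "s \<in> S"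
  shows "dst h g \<le> dst h (g \<otimes> s) + 1"
  using dst_triangle[of h "g \<otimes> s" g] dst_sym[of "g \<otimes> s" g] len_gen[OF assms(3)] assms S_carrier by simp

text \<open>A letter lowers four times the distance from \<open>H\<close> by at most 4, and the
  potential falls by at least as much, so the inequality survives in the middle of a
  cascade.\<close>

lemma busy_invariant:
  assumes i: "invariant g m y c j st td tr inp" and m: "m \<noteq> Bottom" and s: "s \<in> S"
    and v: "valid z c' j' st' td' tr' inp'"
    and h: "h \<in> H" "total z c' st' td' tr' inp' = h \<otimes> (total y c st td tr inp \<otimes> s)"
    and p: "potential z j' st' td' tr' inp' + 4 \<le> potential y j st td tr inp"
  shows "invariant (g \<otimes> s) Busy z c' j' st' td' tr' inp'"
proof -
  let ?t = "total y c st td tr inp"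
  have vo: "valid y c j st td tr inp" using i by (simp add: invariant_def)
  have t: "?t \<in> carrier G" using total_closed[OF vo] .
  have s': "s \<in> carrier G" using s by (rule S_carrier)
  obtain h0 where h0: "h0 \<in> H" "g = h0 \<otimes> ?t" using i by (auto simp: invariant_def)
  have "h0 \<otimes> inv h \<otimes> (h \<otimes> (?t \<otimes> s)) = h0 \<otimes> ((inv h \<otimes> h) \<otimes> (?t \<otimes> s))"
    using h0 h t s' by (simp only: m_assoc m_closed inv_closed H_carrier)
  then have "g \<otimes> s = (h0 \<otimes> inv h) \<otimes> total z c' st' td' tr' inp'"
    using h0 h t s' by (simp add: m_assoc)
  then have "\<exists>h \<in> H. g \<otimes> s = h \<otimes> total z c' st' td' tr' inp'" using h0 h by auto
  moreover have "potential z j' st' td' tr' inp' < 4 * dst h' (g \<otimes> s)" if "h' \<in> H" for h'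
  proof -
    have "potential y j st td tr inp < 4 * dst h' g" using i m that by (simp add: invariant_def)
    then show ?thesis using dst_drop[OF that _ s, of g] h0 t p by simp
  qed
  ultimately show ?thesis using v by (simp add: invariant_def)
qed

text \<open>Here the inequality is obtained afresh from the geometry of the chain, whatever the
  potential was before. The factor \<open>h\<close> is removed by a left translation that maps
  \<open>H\<close> to itself.\<close>

lemma settled_invariant:
  assumes g: "g = h \<otimes> (product_up st \<otimes> y)" "h \<in> H" and st: "chain st" "st \<noteq> []"
    and y: "y \<in> carrier G" "good (top_of st) y"
  shows "invariant g Settled y \<one> 0 st [] [] []"
proof -
  have c: "product_up st \<in> carrier G" using chain_carrier[OF st(1)] by simp
  have t: "total y \<one> st [] [] [] = product_up st \<otimes> y" using c y by (simp add: total_def)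
  have "potential y 0 st [] [] [] < 4 * dst h' g" if h': "h' \<in> H" for h'
  proof -
    have "h \<otimes> (inv h \<otimes> h') = h'" using g(2) h' by (simp add: m_assoc[symmetric])
    then have "dst h' g = dst (inv h \<otimes> h') (product_up st \<otimes> y)"
      using dst_left[of h "inv h \<otimes> h'" "product_up st \<otimes> y"] g c y h' by simp
    then show ?thesis using nonempty_chain_far[of "inv h \<otimes> h'" st y] g(2) h' st y
      by (simp add: potential_def)
  qed
  then show ?thesis using g st y t by (auto simp: invariant_def valid_def)
qed

lemma direct_step:
  assumes i: "invariant g m y c j st [] [] []" and s: "s \<in> S"
    and mv: "direct_move (top_of st) (y \<otimes> c \<otimes> s) = (m', z, a0, a1)"
  shows "invariant (g \<otimes> s) m' z \<one> 0 (apply_op a0 st) (apply_op a1 []) [] []"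
proof -
  have v: "valid y c j st [] [] []" using i by (simp add: invariant_def)
  note c = valid_closed[OF v]
  have s': "s \<in> carrier G" using s by (rule S_carrier)
  have ch: "chain st" using v by (simp add: valid_def)
  let ?y = "y \<otimes> c \<otimes> s"
  have y: "?y \<in> carrier G" using c s' by simp
  have stc: "product_up st \<in> carrier G" using c by simp
  have t: "total y c st [] [] [] = product_up st \<otimes> (y \<otimes> c)"
    using c by (simp add: total_def)
  obtain h where h: "h \<in> H" "g \<otimes> s = h \<otimes> (product_up st \<otimes> ?y)"
  proof -
    obtain h where "h \<in> H" "g = h \<otimes> (product_up st \<otimes> (y \<otimes> c))"
      using i t by (auto simp: invariant_def)
    then show thesis using c s' stc by (intro that[of h]) (simp_all add: m_assoc)
  qed
  \<comment> \<open>Serves both ways of staying at the bottom: \<open>h'\<close> is 1 if the product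
    is kept and comes from \<open>coset_min\<close> otherwise.\<close>
  have bottom: "invariant (g \<otimes> s) Bottom w \<one> 0 [] [] [] []"
    if "st = []" "w \<in> carrier G" "h' \<in> H" "w = h' \<otimes> ?y" for w h'
  proof -
    have "h \<otimes> ?y = (h \<otimes> inv h') \<otimes> w"
    proof -
      have "(h \<otimes> inv h') \<otimes> (h' \<otimes> ?y) = h \<otimes> ((inv h' \<otimes> h') \<otimes> ?y)"
        using h(1) that(3) y by (simp only: m_assoc m_closed inv_closed H_carrier)
      then show ?thesis using h(1) that y by simp
    qed
    then have "\<exists>h \<in> H. g \<otimes> s = h \<otimes> total w \<one> [] [] [] []"
      using h that y by (auto simp: total_def intro!: bexI[of _ "h \<otimes> inv h'"])
    then show ?thesis using that by (simp add: invariant_def valid_def)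
  qed
  show ?thesis
  proof (cases "good (top_of st) ?y")
    case good: True
    show ?thesis
    proof (cases "2 * block \<le> len ?y")
      case True
      then have e: "m' = Settled" "z = suf block ?y" "a0 = Push (pre block ?y)" "a1 = Keep"
        using mv good by simp_all
      from True have b: "block \<le> len ?y" by simp
      show ?thesis unfolding e apply_op.simps
      proof (rule settled_invariant[of _ h])
        show "g \<otimes> s = h \<otimes> (product_up (pre block ?y # st) \<otimes> suf block ?y)"
          unfolding push_step(2)[OF ch y b good] by (rule h(2))
        show "good (top_of (pre block ?y # st)) (suf block ?y)"
          using good_pre_suf[OF y b] by simp
      qed (use h push_step[OF ch y b good] pre_suf[OF y b] in simp_all)
    next
      case short: False
      then have e: "z = ?y" "a0 = Keep" "a1 = Keep" using mv good by simp_all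
      show ?thesis
      proof (cases st)
        case Nil
        then have m': "m' = Bottom" using mv good short by simp
        show ?thesis using bottom[of ?y \<one>] Nil y unfolding e m' by simp
      next
        case (Cons b st0)
        then have "m' = Settled" using mv good short by simp
        then show ?thesis using settled_invariant[OF h(2,1) ch _ y good] Cons e by simp
      qed
    qed
  next
    case bad: False
    show ?thesis
    proof (cases st)
      case Nil
      then have e: "m' = Bottom" "z = coset_min ?y" "a0 = Keep" "a1 = Keep" using mv bad by simp_all
      obtain h' where "h' \<in> H" "coset_min ?y = h' \<otimes> ?y" using coset_min(1) by blast
      then show ?thesis using bottom[of "coset_min ?y" h'] Nil y unfolding e by simp
    next
      case (Cons b st0)
      obtain w a where red: "reduce (top_of st) ?y = (w, a)" by force
      then have e: "m' = Busy" "z = w" "a0 = Pop" "a1 = a" using mv bad Cons by simp_all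
      obtain h' ds where r: "h' \<in> H" "\<And>td. apply_op a td = ds @ td" "set ds \<subseteq> carrier G" "length ds \<le> 1"
        "w \<in> carrier G" "product_up (tl st) \<otimes> (w \<otimes> product_down ds) = h' \<otimes> (product_up st \<otimes> ?y)"
        "block * length (tl st) + len w + sum_list (map len ds) + slack < block * length st + len ?y"
        using reduce_step[OF ch y bad red] by metis
      have ch': "chain (tl st)" using ch by (cases st) simp_all
      have tl: "product_up (tl st) \<in> carrier G" using chain_carrier[OF ch'] by simp
      have m: "m \<noteq> Bottom" using i Cons by (auto simp: invariant_def)
      have "total w \<one> (tl st) ds [] [] = product_up (tl st) \<otimes> (w \<otimes> product_down ds)"
        using r(3,5) tl by (simp add: total_def)
      also have "\<dots> = h' \<otimes> (total y c st [] [] [] \<otimes> s)"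
        unfolding r(6) t using c s' stc by (simp add: m_assoc)
      finally have T: "total w \<one> (tl st) ds [] [] = h' \<otimes> (total y c st [] [] [] \<otimes> s)" .
      \<comment> \<open>Multiplying in \<open>c\<close> and \<open>s\<close> costs at most
        \<open>2 * (j + 1)\<close>, while \<open>5 * j\<close> is released and the repair gains more
        than \<open>2 * slack\<close>, of which a new piece takes \<open>slack\<close>.\<close>
      have "len ?y \<le> len y + j + 1"
        using len_mult[of "y \<otimes> c" s] len_mult[of y c] c s' len_gen[OF s] v by (simp add: valid_def)
      then have P: "potential w 0 (tl st) ds [] [] + 4 \<le> potential y j st [] [] []"
        using r(4,7) by (simp add: potential_def)
      have "valid w \<one> 0 (tl st) ds [] []" using ch' r(3,5) by (simp add: valid_def)
      from busy_invariant[OF i m s this r(1) T P] show ?thesis unfolding e using r(2)[of "[]"] by simp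
    qed
  qed
qed

section \<open>Correctness of the machine\<close>

definition config_inv :: "'a \<Rightarrow> 'a state \<times> 'a list list \<Rightarrow> bool" where
  "config_inv g C \<longleftrightarrow> (\<exists>m f y c j st td tr inp. invariant g m y c j st td tr inp \<and>
     C = ((m, f, y, c, j), [st, td] @ (if f then [tr, inp] else [inp, tr])))"

lemma top_of_None [simp]: "top_of st = None \<longleftrightarrow> st = []"
  by (cases st) simp_all

lemma config_inv_step:
  assumes C: "config_inv g C" and s: "s \<in> S"
  shows "config_inv (g \<otimes> s) (stack_step delta C s)"
proof -
  obtain m f y c j st td tr inp where i: "invariant g m y c j st td tr inp"
    and C_def: "C = ((m, f, y, c, j), [st, td] @ (if f then [tr, inp] else [inp, tr]))"
    using C by (auto simp: config_inv_def)
  show ?thesis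
  proof (cases "td = [] \<and> tr = [] \<and> inp = []")
    case True
    obtain m' z a0 a1 where mv: "direct_move (top_of st) (y \<otimes> c \<otimes> s) = (m', z, a0, a1)"
      by (metis prod_cases4)
    have "stack_step delta C s = ((m', f, z, \<one>, 0), [apply_op a0 st, apply_op a1 []] @ [[], []])"
      using True mv by (simp add: C_def stack_step_def Let_def del: direct_move.simps)
    then show ?thesis using direct_step[OF _ s mv, of g m j] i True
      unfolding config_inv_def by (intro exI[of _ m'] exI[of _ f] exI[of _ z] exI conjI) auto
  next
    case False
    obtain z a0 a1 ar swap where
      mv: "busy_move (top_of st) (top_of td) (top_of tr) y = (z, a0, a1, ar, swap)" by (metis prod_cases5)
    obtain c' j' ai where ch: "chunk c j s = (c', j', ai)" by (metis prod_cases3)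
    have v: "valid y c j st td tr inp" using i by (simp add: invariant_def)
    have m: "m \<noteq> Bottom" using i False by (auto simp: invariant_def)
    note cs = chunk_step[OF v s ch]
    \<comment> \<open>The machine does both at once; here the letter is accounted for first. The
      other move reads only the remaining three stacks, so it is unaffected, and a swap hands over
      the updated \<open>inp\<close>.\<close>
    let ?inp = "apply_op ai inp"
    let ?tr' = "if swap then ?inp else apply_op ar tr" and ?inp' = "if swap then apply_op ar tr else ?inp"
    have "\<not> (td = [] \<and> tr = [] \<and> ?inp = [])" using False cs(4) by blast
    note bs = busy_step[OF cs(1) this mv]
    obtain h where h: "h \<in> H" "total z c' (apply_op a0 st) (apply_op a1 td) ?tr' ?inp' =
        h \<otimes> (total y c st td tr inp \<otimes> s)" using bs cs(2) by auto
    have "potential z j' (apply_op a0 st) (apply_op a1 td) ?tr' ?inp' + 4 \<le> potential y j st td tr inp"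
      using bs cs(3) by linarith
    from busy_invariant[OF i m s _ h this] bs
    have "invariant (g \<otimes> s) Busy z c' j' (apply_op a0 st) (apply_op a1 td) ?tr' ?inp'" by blast
    moreover have "stack_step delta C s = ((Busy, f \<noteq> swap, z, c', j'), [apply_op a0 st, apply_op a1 td] @
        (if f \<noteq> swap then [?tr', ?inp'] else [?inp', ?tr']))"
      using False mv ch by (cases f; cases swap)
        (auto simp: C_def stack_step_def Let_def simp del: busy_move.simps chunk.simps)
    ultimately show ?thesis unfolding config_inv_def by blast
  qed
qed

definition initial :: "'a state" where
  "initial = (Bottom, True, \<one>, \<one>, 0)"

lemma config_inv_run:
  "w \<in> lists S \<Longrightarrow> config_inv (ev w) (foldl (stack_step delta) (initial, replicate 4 []) w)"
proof (induction w rule: rev_induct)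
  case Nil
  have "invariant \<one> Bottom \<one> \<one> 0 [] [] [] []"
    by (auto simp: invariant_def valid_def total_def intro!: bexI[of _ \<one>])
  then have "config_inv \<one> (initial, [[], []] @ (if True then [[], []] else [[], []]))"
    unfolding config_inv_def initial_def by blast
  then show ?case by (simp add: numeral_eq_Suc)
next
  case (snoc s w)
  then have "ev (w @ [s]) = ev w \<otimes> s" using ev_append[of w "[s]"] S_carrier by simp
  then show ?case using config_inv_step[OF snoc.IH, of s] snoc.prems by simp
qed

theorem GWP_real_time: "real_time_language S (GWP G H S)"
proof (rule stack_machine_real_time[where Q = states and \<Gamma> = symbols and k = 4 and \<delta> = delta
      and ?q0.0 = initial and F = "{(m, f, y, c, j). m = Bottom \<and> y \<in> H}"])
  show "finite states" "finite symbols" by (rule finite_states_symbols)+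
  show "initial \<in> states" by (simp add: initial_def states_def)
  show "GWP G H S \<subseteq> lists S" by (auto simp: GWP_def)
  show "q' \<in> states \<and> length acts = 4 \<and> (\<forall>x. Push x \<in> set acts \<longrightarrow> x \<in> symbols)"
    if "q \<in> states" "a \<in> S" "length ts = 4" "\<And>x. Some x \<in> set ts \<Longrightarrow> x \<in> symbols"
      "delta q a ts = (q', acts)" for q a ts q' acts
    using delta_closed that by blast
  fix w assume w: "w \<in> lists S"
  obtain m f y c j st td tr inp where i: "invariant (ev w) m y c j st td tr inp"
    and C: "fst (foldl (stack_step delta) (initial, replicate 4 []) w) = (m, f, y, c, j)"
    using config_inv_run[OF w] by (auto simp: config_inv_def)
  have "ev w \<in> H \<longleftrightarrow> m = Bottom \<and> y \<in> H"
  proof (cases "m = Bottom")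
    case True
    have y: "y \<in> carrier G" using i by (simp add: invariant_def valid_def)
    obtain h where h: "h \<in> H" "ev w = h \<otimes> y"
      using i True y by (auto simp: invariant_def total_def)
    have "y = inv h \<otimes> ev w" using h y by (simp add: m_assoc[symmetric])
    then show ?thesis using True h H_closed by metis
  next
    \<comment> \<open>For a word in \<open>H\<close> the invariant could be applied with
      \<open>ev w\<close> itself as \<open>h\<close>, putting a natural number below 0.\<close>
    case False
    then have "0 < 4 * dst (ev w) (ev w)" if "ev w \<in> H"
      using i that by (fastforce simp: invariant_def)
    then show ?thesis using False w by auto
  qed
  then show "w \<in> GWP G H S \<longleftrightarrow>
      fst (foldl (stack_step delta) (initial, replicate 4 []) w) \<in> {(m, f, y, c, j). m = Bottom \<and> y \<in> H}"
    using w C by (simp add: GWP_def)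
qed

end

theorem theorem1p2:
  fixes G :: "('g, 'b) monoid_scheme" and S :: "'g set" and H :: "'g set"
  assumes "hyperbolic_group G S"
    and "subgroup H G"
    and "quasiconvex G S H"
    and "almost_malnormal G H \<or>
         (\<forall>h \<in> H. h \<noteq> \<one>\<^bsub>G\<^esub> \<longrightarrow> finite_centraliser_index G H h)"
  shows "real_time_language S (GWP G H S)"
proof -
  obtain \<delta> where gen: "group G" "fin_inv_gen_set G S"
    and slim: "\<And>u v w. \<lbrakk>geodesic_word G S u; geodesic_word G S v; geodesic_word G S w;
       word_eval G u \<otimes>\<^bsub>G\<^esub> word_eval G v = word_eval G w\<rbrakk> \<Longrightarrow>
       close_to G S \<delta> (path_points G \<one>\<^bsub>G\<^esub> w)
         (path_points G \<one>\<^bsub>G\<^esub> u \<union> path_points G (word_eval G u) v)"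
    using assms(1) unfolding hyperbolic_group_def Let_def by blast
  obtain \<kappa> where qc: "\<And>w p. \<lbrakk>geodesic_word G S w; word_eval G w \<in> H; p \<in> path_points G \<one>\<^bsub>G\<^esub> w\<rbrakk> \<Longrightarrow>
      \<exists>h \<in> H. cayley_dist G S p h \<le> \<kappa>"
    using assms(3) unfolding quasiconvex_def by blast
  have "quasiconvex_subgroup G S \<delta> H \<kappa>"
    by (intro quasiconvex_subgroup.intro hyperbolic.intro cayley.intro cayley_axioms.intro
        hyperbolic_axioms.intro quasiconvex_subgroup_axioms.intro) (fact gen slim assms(2) qc)+
  then show ?thesis by (rule quasiconvex_subgroup.GWP_real_time)
qed

end
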